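(* Let $n\ge1$ and let $\mathcal{A}\subset\mathbb{Z}_{\ge0}^n$ be a finite subset such that $\{0,v_1,\ldots,v_n\}\subset\mathcal{A}$, where $v_i=(0,\ldots,d_{\mathcal{A}},\ldots,0)$ with $d_{\mathcal{A}}$ in position $i$. Then $$n_0(\mathcal{A})\le(d_{\mathcal{A}}-1)(|\mathcal{A}|-n-1)+1.$$ Moreover, if $\deg(Y_{n,d_{\mathcal{A}}})\ge|\mathcal{A}|-n+1$, then $$n_0(\mathcal{A})\le\min\{(n+1)(\deg(Y_{n,d_{\mathcal{A}}})-|\mathcal{A}|+n-1)+3,\ (d_{\mathcal{A}}-1)(|\mathcal{A}|-n-1)+1\}.$$
   Context: $\mathbb{K}$ is an algebraically closed field of characteristic zero and $R=\mathbb{K}[x_0,\ldots,x_n]$. For $t\ge1$, $t\mathcal{A}=\{a_1+\cdots+a_t\mid a_i\in\mathcal{A}\}$ (repetitions allowed), $0\mathcal{A}=\{0\}$, and $\varphi_{\mathcal{A}}(t)=|t\mathcal{A}|$. There is a polynomial $p_{\mathcal{A}}\in\mathbb{Q}[t]$ with $\varphi_{\mathcal{A}}(t)=p_{\mathcal{A}}(t)$ for $t\gg0$ (Khovanskii), and the phase transition is $n_0(\mathcal{A})=\min\{n_0\in\mathbb{Z}_{\ge0}\mid\varphi_{\mathcal{A}}(t)=p_{\mathcal{A}}(t)\ \forall t\ge n_0\}$. For $a\in\mathcal{A}$ put $|a|=a_1+\cdots+a_n$, and let $d_{\mathcal{A}}$ be the least integer $\delta\ge0$ with $|a|\le\delta$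 for all $a\in\mathcal{A}$; here $d_{\mathcal{A}}\ge1$, so that the convex hull of $\mathcal{A}$ is the $n$-simplex with vertices $0,v_1,\ldots,v_n$. The variety $Y_{n,d_{\mathcal{A}}}\subset\mathbb{P}^{|\mathcal{A}|-1}$ is the Zariski closure of the image of the rational map $\mathbb{P}^n\dashrightarrow\mathbb{P}^{|\mathcal{A}|-1}$ with coordinates the monomials $x_0^{d_{\mathcal{A}}-|a|}x_1^{a_1}\cdots x_n^{a_n}$, $a\in\mathcal{A}$. *)

theory Defs
  imports
    "HOL-Computational_Algebra.Polynomial"
    "HOL-Library.Poly_Mapping"
    Complex_Main
begin

section \<open>Eventually polynomial functions\<close>

text \<open>Two polynomials that agree at all large natural numbers are equal, so the
  description below is unique as soon as a suitable polynomial exists.\<close>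

definition eventual_poly :: "(nat \<Rightarrow> nat) \<Rightarrow> rat poly" where
  "eventual_poly f = (THE p. \<exists>N. \<forall>t\<ge>N. of_nat (f t) = poly p (of_nat t))"

lemma eventual_polyI:
  assumes p: "\<And>t. t \<ge> N \<Longrightarrow> of_nat (f t) = poly p (of_nat t)"
  shows "eventual_poly f = p"
  unfolding eventual_poly_def
proof (rule the_equality)
  show "\<exists>N. \<forall>t\<ge>N. of_nat (f t) = poly p (of_nat t)"
    using p by blast
next
  fix q :: "rat poly"
  assume "\<exists>N. \<forall>t\<ge>N. of_nat (f t) = poly q (of_nat t)"
  then obtain M where q: "\<And>t. t \<ge> M \<Longrightarrow> of_nat (f t) = poly q (of_nat t)"
    by blast
  have "of_nat ` {max M N..} \<subseteq> {x. poly (q - p) x = 0}"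
    using p q by (auto simp: p[symmetric] q[symmetric])
  moreover have "infinite ((of_nat :: nat \<Rightarrow> rat) ` {max M N..})"
    by (simp add: finite_image_iff infinite_Ici)
  ultimately have "infinite {x. poly (q - p) x = 0}"
    using finite_subset by blast
  then show "q = p"
    using poly_roots_finite[of "q - p"] by auto
qed


section \<open>Sumsets and the phase transition\<close>

text \<open>A vector of \<open>\<int>\<^sub>\<ge>\<^sub>0\<^sup>n\<close> is a finitely supported function on the naturals whose support
  lies in \<open>{1..n}\<close>. The same type, over an arbitrary index type, serves for exponent vectors
  of monomials.\<close>

definition nat_vectors :: "nat \<Rightarrow> (nat \<Rightarrow>\<^sub>0 nat) set" where
  "nat_vectors n = {a. Poly_Mapping.keys a \<subseteq> {1..n}}"

definition total :: "('i \<Rightarrow>\<^sub>0 nat) \<Rightarrow> nat" where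
  "total a = (\<Sum>i\<in>Poly_Mapping.keys a. Poly_Mapping.lookup a i)"

definition sumset :: "nat \<Rightarrow> 'a::comm_monoid_add set \<Rightarrow> 'a set" where
  "sumset t A = {\<Sum>i<t. a i |a. \<forall>i<t. a i \<in> A}"

definition sumset_card :: "'a::comm_monoid_add set \<Rightarrow> nat \<Rightarrow> nat" where
  "sumset_card A t = card (sumset t A)"

definition phase_transition :: "'a::comm_monoid_add set \<Rightarrow> nat" where
  "phase_transition A =
     (LEAST n0. \<forall>t\<ge>n0. of_nat (sumset_card A t) = poly (eventual_poly (sumset_card A)) (of_nat t))"

definition max_total :: "(nat \<Rightarrow>\<^sub>0 nat) set \<Rightarrow> nat" where
  "max_total A = (LEAST \<delta>. \<forall>a\<in>A. total a \<le> \<delta>)"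


section \<open>Projective varieties\<close>

text \<open>Projective space with coordinates indexed by a finite set \<open>I\<close>: coordinate vectors
  vanish outside \<open>I\<close>, and a point is the set of its vectors of homogeneous coordinates,
  i.e. a class of nonzero vectors modulo nonzero scalars.\<close>

type_synonym ('i, 'k) point = "('i \<Rightarrow> 'k) set"

definition proj_point :: "('i \<Rightarrow> 'k::field) \<Rightarrow> ('i, 'k) point" where
  "proj_point v = {\<lambda>i. c * v i |c. c \<noteq> 0}"

definition coord_vectors :: "'i set \<Rightarrow> ('i \<Rightarrow> 'k::field) set" where
  "coord_vectors I = {v. (\<forall>i. i \<notin> I \<longrightarrow> v i = 0) \<and> (\<exists>i\<in>I. v i \<noteq> 0)}"

definition proj_space :: "'i set \<Rightarrow> ('i, 'k::field) point set" where
  "proj_space I = proj_point ` coord_vectors I"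

text \<open>Polynomials with variables indexed by \<open>'i\<close> are finitely supported functions from
  exponent vectors to coefficients.\<close>

type_synonym ('i, 'k) mpoly = "('i \<Rightarrow>\<^sub>0 nat) \<Rightarrow>\<^sub>0 'k"

definition monomial_value :: "('i \<Rightarrow>\<^sub>0 nat) \<Rightarrow> ('i \<Rightarrow> 'k::field) \<Rightarrow> 'k" where
  "monomial_value m v = (\<Prod>i\<in>Poly_Mapping.keys m. v i ^ Poly_Mapping.lookup m i)"

definition mpoly_eval :: "('i, 'k::field) mpoly \<Rightarrow> ('i \<Rightarrow> 'k) \<Rightarrow> 'k" where
  "mpoly_eval f v =
     (\<Sum>m\<in>Poly_Mapping.keys f. Poly_Mapping.lookup f m * monomial_value m v)"

definition mpoly_scale :: "'k::field \<Rightarrow> ('i, 'k) mpoly \<Rightarrow> ('i, 'k) mpoly" where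
  "mpoly_scale c f = Poly_Mapping.map (\<lambda>x. c * x) f"

lemma lookup_mpoly_scale [simp]:
  "Poly_Mapping.lookup (mpoly_scale c f) m = c * Poly_Mapping.lookup f m"
  by (simp add: mpoly_scale_def Poly_Mapping.map.rep_eq when_def)

lemma vector_space_mpoly_scale: "vector_space mpoly_scale"
  by unfold_locales (auto intro!: poly_mapping_eqI simp: lookup_add algebra_simps)

text \<open>The space of forms of degree \<open>t\<close> in the variables indexed by \<open>I\<close>, including \<open>0\<close>.\<close>

definition homogeneous :: "'i set \<Rightarrow> nat \<Rightarrow> ('i, 'k::field) mpoly set" where
  "homogeneous I t =
     {f. \<forall>m\<in>Poly_Mapping.keys f. Poly_Mapping.keys m \<subseteq> I \<and> total m = t}"

definition vanishes_at :: "('i, 'k::field) mpoly \<Rightarrow> ('i, 'k) point \<Rightarrow> bool" where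
  "vanishes_at f P \<longleftrightarrow> (\<forall>v\<in>P. mpoly_eval f v = 0)"

definition zariski_closed :: "'i set \<Rightarrow> ('i, 'k::field) point set \<Rightarrow> bool" where
  "zariski_closed I Z \<longleftrightarrow>
     (\<exists>F \<subseteq> (\<Union>t. homogeneous I t). Z = {P \<in> proj_space I. \<forall>f\<in>F. vanishes_at f P})"

definition zariski_closure ::
    "'i set \<Rightarrow> ('i, 'k::field) point set \<Rightarrow> ('i, 'k) point set" where
  "zariski_closure I X = \<Inter>{Z. zariski_closed I Z \<and> X \<subseteq> Z}"

text \<open>The degree-\<open>t\<close> component of the homogeneous vanishing ideal.\<close>

definition vanishing_forms ::
    "'i set \<Rightarrow> ('i, 'k::field) point set \<Rightarrow> nat \<Rightarrow> ('i, 'k) mpoly set" where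
  "vanishing_forms I Y t = {f \<in> homogeneous I t. \<forall>P\<in>Y. vanishes_at f P}"

text \<open>The Hilbert function of the homogeneous coordinate ring \<open>S/I(Y)\<close>. For finite \<open>I\<close>, the
  space of forms of degree \<open>t\<close> is finite-dimensional, so the difference is the dimension of the
  quotient \<open>(S/I(Y))\<^sub>t\<close>.\<close>

definition hilbert_function ::
    "'i set \<Rightarrow> ('i, 'k::field) point set \<Rightarrow> nat \<Rightarrow> nat" where
  "hilbert_function I Y t =
     vector_space.dim mpoly_scale (homogeneous I t :: ('i, 'k) mpoly set)
     - vector_space.dim mpoly_scale (vanishing_forms I Y t)"

definition hilbert_poly :: "'i set \<Rightarrow> ('i, 'k::field) point set \<Rightarrow> rat poly" where
  "hilbert_poly I Y = eventual_poly (hilbert_function I Y)"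

text \<open>The degree of a nonempty projective variety \<open>Y\<close>: \<open>r!\<close> times the leading coefficient of its
  Hilbert polynomial, where \<open>r\<close> is the degree of that polynomial, i.e. the dimension of \<open>Y\<close>.\<close>

definition variety_degree :: "'i set \<Rightarrow> ('i, 'k::field) point set \<Rightarrow> rat" where
  "variety_degree I Y = fact (degree (hilbert_poly I Y)) * lead_coeff (hilbert_poly I Y)"


section \<open>The variety parametrized by monomials\<close>

text \<open>Coordinates of the source \<open>\<bbbP>\<^sup>n\<close> are indexed by \<open>{0..n}\<close>, and coordinates of the target
  \<open>\<bbbP>\<^bsup>|A|-1\<^esup>\<close> by \<open>A\<close> itself.\<close>

definition monomial_coords ::
    "nat \<Rightarrow> (nat \<Rightarrow>\<^sub>0 nat) set \<Rightarrow> (nat \<Rightarrow> 'k::field) \<Rightarrow> (nat \<Rightarrow>\<^sub>0 nat) \<Rightarrow> 'k" where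
  "monomial_coords n A x a =
     (if a \<in> A
      then x 0 ^ (max_total A - total a) * (\<Prod>i=1..n. x i ^ Poly_Mapping.lookup a i)
      else 0)"

text \<open>The rational map is evaluated wherever its coordinate monomials do not all vanish.\<close>

definition monomial_image ::
    "nat \<Rightarrow> (nat \<Rightarrow>\<^sub>0 nat) set \<Rightarrow> (nat \<Rightarrow>\<^sub>0 nat, 'k::field) point set" where
  "monomial_image n A =
     {proj_point (monomial_coords n A x) |x.
        x \<in> coord_vectors {0..n} \<and> monomial_coords n A x \<in> coord_vectors A}"

definition monomial_variety ::
    "nat \<Rightarrow> (nat \<Rightarrow>\<^sub>0 nat) set \<Rightarrow> (nat \<Rightarrow>\<^sub>0 nat, 'k::field) point set" where
  "monomial_variety n A = zariski_closure A (monomial_image n A)"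

end

theory Submission
  imports Defs "HOL-Library.FuncSet"
begin

text \<open>Write \<open>d = max_total A\<close> and let \<open>c\<close> be the number of elements of \<open>A\<close> other than the vertices of the
  simplex, so that \<open>card A = c + n + 1\<close>. Homogenization turns \<open>A\<close> into a set \<open>H\<close> of vectors of total
  \<open>d\<close> in the variables \<open>0, \<dots>, n\<close>, and \<open>tA\<close> into the part of degree \<open>t\<close> of the semigroup \<open>S\<close>
  generated by \<open>H\<close>. As \<open>S\<close> contains \<open>d\<close> times every unit vector, it splits into residue classes
  modulo \<open>d\<close>, and in each class the vectors of quotients by \<open>d\<close> form an up-set in
  \<open>\<nat>\<^bsup>n+1\<^esup>\<close>, that is, a monomial ideal. If all its minimal elements lie below \<open>m\<close>, a decomposition
  into cells shows that its Hilbert function is a polynomial of degree \<open>n\<close> with leading coefficient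
  \<open>1 / fact n\<close> from degree \<open>total m - n\<close> on, up to the shift by the degree of the class
  (\<open>card_upset_eventually_poly\<close>). Summing over the classes, both bounds reduce to bounding minimal
  elements (\<open>card_sumset_eventually_poly\<close>).

  A minimal element is a sum of nonvertices in which no partial sum can be exchanged for a smaller
  congruent element of \<open>S\<close> (\<open>minimal_no_congruent_below\<close>). On the one hand, each nonvertex then occurs
  at most \<open>d - 1\<close> times, so all minimal elements lie below a single vector of degree \<open>(d - 1) * c\<close>;
  this is the first bound. On the other hand, the partial sums have distinct residues and, from two
  terms on, avoid those of \<open>0\<close> and of the nonvertices. If there are \<open>\<delta>\<close> residue classes, the number of
  terms is therefore at most \<open>\<delta> - c\<close> (\<open>minimal_length_le\<close>), and this gives the second bound.

  It remains to see that \<open>\<delta>\<close> is the degree of the variety. A form vanishes on it if and only if its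
  pullback along the monomial parametrization is the zero polynomial, by the linear independence of
  monomials. Hence the Hilbert function at \<open>t\<close> counts the monomials of the pullbacks, whose exponents
  are exactly the elements of the homogenized \<open>tA\<close> (\<open>hilbert_function_monomial_variety\<close>). So the
  Hilbert polynomial is the polynomial of the sumset sizes, with leading coefficient
  \<open>\<delta> / fact n\<close>.\<close>


section \<open>Vectors of natural numbers\<close>

abbreviation lookup :: "('a \<Rightarrow>\<^sub>0 'b::zero) \<Rightarrow> 'a \<Rightarrow> 'b" where
  "lookup \<equiv> Poly_Mapping.lookup"

abbreviation keys :: "('a \<Rightarrow>\<^sub>0 'b::zero) \<Rightarrow> 'a set" where
  "keys \<equiv> Poly_Mapping.keys"

definition vec_of :: "'i set \<Rightarrow> ('i \<Rightarrow> nat) \<Rightarrow> 'i \<Rightarrow>\<^sub>0 nat" where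
  "vec_of I f = (\<Sum>i\<in>I. Poly_Mapping.single i (f i))"

lemma lookup_vec_of:
  assumes "finite I"
  shows "lookup (vec_of I f) i = (if i \<in> I then f i else 0)"
proof -
  have "lookup (vec_of I f) i = (\<Sum>j\<in>I. if j = i then f j else 0)"
    by (simp add: vec_of_def lookup_sum lookup_single when_def)
  then show ?thesis using assms by simp
qed

lemma keys_vec_of:
  assumes "finite I"
  shows "keys (vec_of I f) \<subseteq> I"
  using assms by (auto simp: in_keys_iff lookup_vec_of split: if_splits)

lemma lookup_outside: "keys q \<subseteq> I \<Longrightarrow> i \<notin> I \<Longrightarrow> lookup q i = 0"
  by (auto simp: in_keys_iff)

lemma keys_add_subset: "keys q \<subseteq> I \<Longrightarrow> keys r \<subseteq> I \<Longrightarrow> keys (q + r) \<subseteq> I"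
  for q r :: "'i \<Rightarrow>\<^sub>0 nat"
  using keys_add[of q r] by blast

lemma vec_eqI:
  assumes "keys q \<subseteq> I" "keys r \<subseteq> I" "\<And>i. i \<in> I \<Longrightarrow> lookup q i = lookup r i"
  shows "q = r"
  using assms by (intro poly_mapping_eqI) (metis lookup_outside)

lemma total_eq_sum:
  assumes "finite I" "keys q \<subseteq> I"
  shows "total q = (\<Sum>i\<in>I. lookup q i)"
  unfolding total_def using assms by (intro sum.mono_neutral_left) (auto simp: in_keys_iff)

lemma total_zero [simp]: "total 0 = 0"
  by (simp add: total_def)

lemma total_add: "total (q + r) = total q + total r"
proof -
  let ?I = "keys q \<union> keys r"
  have "total (q + r) = (\<Sum>i\<in>?I. lookup (q + r) i)"
    by (intro total_eq_sum keys_add) auto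
  then show ?thesis
    by (simp add: lookup_add sum.distrib total_eq_sum[of ?I])
qed

lemma total_single [simp]: "total (Poly_Mapping.single i k) = k"
  by (simp add: total_def)

lemma total_vec_of: "finite I \<Longrightarrow> total (vec_of I f) = (\<Sum>i\<in>I. f i)"
  by (simp add: total_eq_sum[OF _ keys_vec_of] lookup_vec_of)

lemma total_eq_0_iff: "total q = 0 \<longleftrightarrow> q = 0"
proof
  assume "total q = 0"
  then have "lookup q i = 0" for i by (auto simp: total_def in_keys_iff)
  then show "q = 0" by (intro poly_mapping_eqI) simp
qed simp

lemma lookup_le_total: "lookup q i \<le> total q"
  by (cases "i \<in> keys q") (auto simp: total_def in_keys_iff intro: member_le_sum)

text \<open>Listing the elements of \<open>K\<close> turns such vectors into lists, for which stars and bars applies. On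
  natural numbers the right-hand side is also correct for \<open>K = {}\<close>: it is \<open>1\<close> for \<open>N = 0\<close> and
  \<open>0\<close> otherwise.\<close>

lemma card_vectors_total:
  assumes "finite K"
  shows "card {y. keys y \<subseteq> K \<and> total y = N} = (N + card K - 1) choose N"
proof -
  obtain ks where ks: "set ks = K" "distinct ks"
    using finite_distinct_list[OF assms] by blast
  then have len: "length ks = card K"
    using distinct_card by force
  let ?L = "{l :: nat list. size l = card K \<and> sum_list l = N}"
  have "bij_betw (\<lambda>y. map (lookup y) ks) {y. keys y \<subseteq> K \<and> total y = N} ?L"
  proof (rule bij_betw_imageI)
    show "inj_on (\<lambda>y. map (lookup y) ks) {y. keys y \<subseteq> K \<and> total y = N}"
      by (rule inj_onI, rule vec_eqI[of _ K]) (auto simp: ks map_eq_conv)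
    have "l \<in> (\<lambda>y. map (lookup y) ks) ` {y. keys y \<subseteq> K \<and> total y = N}" if "l \<in> ?L" for l
    proof -
      define f where "f k = l ! (THE j. j < length ks \<and> ks ! j = k)" for k
      have f: "f (ks ! j) = l ! j" if "j < length ks" for j
      proof -
        have "(THE j'. j' < length ks \<and> ks ! j' = ks ! j) = j"
          using that ks by (intro the_equality) (auto simp: nth_eq_iff_index_eq)
        then show ?thesis by (simp add: f_def)
      qed
      have l: "map f ks = l"
        using that len f by (intro nth_equalityI) auto
      have "map (lookup (vec_of K f)) ks = l"
        using ks assms l by (metis (no_types, lifting) lookup_vec_of map_eq_conv)
      moreover have "total (vec_of K f) = N"
        using l that ks(1) assms sum_list_distinct_conv_sum_set[OF ks(2), of f] by (simp add: total_vec_of)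
      ultimately show ?thesis
        using keys_vec_of[OF assms, of f] by (intro image_eqI[of _ _ "vec_of K f"]) auto
    qed
    moreover have "(\<Sum>k\<leftarrow>ks. lookup y k) = total y" if "keys y \<subseteq> K" for y :: "'a \<Rightarrow>\<^sub>0 nat"
      using that ks assms by (simp add: sum_list_distinct_conv_sum_set total_eq_sum)
    then have "(\<lambda>y. map (lookup y) ks) ` {y. keys y \<subseteq> K \<and> total y = N} \<subseteq> ?L"
      using len by (intro image_subsetI) simp
    ultimately show "(\<lambda>y. map (lookup y) ks) ` {y. keys y \<subseteq> K \<and> total y = N} = ?L"
      by (meson equalityI subsetI)
  qed
  then show ?thesis
    by (simp add: bij_betw_same_card card_length_sum_list)
qed

lemma finite_vectors_total:
  assumes "finite K"
  shows "finite {y :: 'i \<Rightarrow>\<^sub>0 nat. keys y \<subseteq> K \<and> total y = N}"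
proof (rule finite_subset)
  show "{y :: 'i \<Rightarrow>\<^sub>0 nat. keys y \<subseteq> K \<and> total y = N} \<subseteq> vec_of K ` (K \<rightarrow>\<^sub>E {..N})"
  proof
    fix y :: "'i \<Rightarrow>\<^sub>0 nat" assume y: "y \<in> {y. keys y \<subseteq> K \<and> total y = N}"
    have "vec_of K (restrict (lookup y) K) = y"
      using y assms lookup_outside[of y K] by (intro poly_mapping_eqI) (auto simp: lookup_vec_of)
    moreover have "restrict (lookup y) K \<in> K \<rightarrow>\<^sub>E {..N}"
      using y lookup_le_total[of y] by auto
    ultimately show "y \<in> vec_of K ` (K \<rightarrow>\<^sub>E {..N})"
      by (metis imageI)
  qed
  show "finite (vec_of K ` (K \<rightarrow>\<^sub>E {..N}))"
    using assms by (intro finite_imageI finite_PiE) auto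
qed


section \<open>Counting points of an up-set\<close>

text \<open>The binomial coefficient \<open>(t - D + k - 1) choose (k - 1)\<close> as a polynomial in \<open>t\<close>. It describes
  the number of vectors of total \<open>t - D\<close> in \<open>k\<close> variables. With no variables this number vanishes
  except at \<open>t = D\<close>, which explains the value \<open>0\<close> for \<open>k = 0\<close>.\<close>

definition simplex_poly :: "nat \<Rightarrow> nat \<Rightarrow> rat poly" where
  "simplex_poly k D = (if k = 0 then 0
     else smult (1 / fact (k - 1)) (\<Prod>j=1..<k. [:of_nat j - of_nat D, 1:]))"

lemma degree_prod_linear: "degree (\<Prod>j=1..<k. [:c j, 1 :: rat:]) = k - 1"
  by (subst degree_prod_eq_sum_degree) auto

lemma degree_simplex_poly: "degree (simplex_poly k D) \<le> k - 1"
  using degree_prod_linear[of "\<lambda>j. of_nat j - of_nat D" k] by (simp add: simplex_poly_def)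

lemma coeff_simplex_poly: "coeff (simplex_poly (Suc k) D) k = 1 / fact k"
proof -
  let ?P = "\<Prod>j=1..<Suc k. [:of_nat j - of_nat D, 1 :: rat:]"
  have "lead_coeff ?P = 1"
    by (subst lead_coeff_prod) simp
  then show ?thesis
    using degree_prod_linear[of "\<lambda>j. of_nat j - of_nat D" "Suc k"]
    by (simp add: simplex_poly_def)
qed

text \<open>The polynomial has the zeros \<open>D - k + 1, \<dots>, D - 1\<close>, where \<open>k = card K\<close>. So it agrees with the
  count already slightly before \<open>D\<close>, where the count becomes nonzero. Without this gain of \<open>k - 1\<close> degrees
  the second bound on the phase transition would not come out.\<close>

lemma card_vectors_shifted:
  assumes K: "finite K" and t: "D < t + card K"
  shows "of_nat (card {y :: 'i \<Rightarrow>\<^sub>0 nat. keys y \<subseteq> K \<and> total y + D = t}) = poly (simplex_poly (card K) D) (of_nat t)"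
proof (cases "D \<le> t")
  case True
  define N where "N = t - D"
  have "{y :: 'i \<Rightarrow>\<^sub>0 nat. keys y \<subseteq> K \<and> total y + D = t} = {y. keys y \<subseteq> K \<and> total y = N}"
    using True by (auto simp: N_def)
  then have *: "card {y :: 'i \<Rightarrow>\<^sub>0 nat. keys y \<subseteq> K \<and> total y + D = t} = (N + card K - 1) choose N"
    by (simp add: card_vectors_total[OF K])
  have tN: "of_nat t = of_nat N + (of_nat D :: rat)"
    using True by (simp add: N_def of_nat_diff)
  show ?thesis
  proof (cases "card K")
    case 0
    then have "N > 0" using t by (simp add: N_def)
    then show ?thesis using * 0 by (simp add: simplex_poly_def)
  next
    case (Suc k)
    have "of_nat ((N + k) choose k) = pochhammer (of_nat (Suc N) :: rat) k / fact k"
      using binomial_gbinomial[of "N + k" k, where ?'a = rat]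
      by (simp add: gbinomial_pochhammer' algebra_simps)
    also have "pochhammer (of_nat (Suc N) :: rat) k = (\<Prod>j=1..<Suc k. of_nat N + of_nat j)"
      unfolding pochhammer_prod
      by (rule prod.reindex_bij_witness[of _ "\<lambda>j. j - 1" Suc]) auto
    also have "\<dots> = (\<Prod>j=1..<Suc k. of_nat j - of_nat D + of_nat t)"
      by (simp add: tN algebra_simps)
    finally show ?thesis
      using * Suc binomial_symmetric[of k "N + k"] by (simp add: simplex_poly_def poly_prod algebra_simps del: prod.op_ivl_Suc)
  qed
next
  case False
  then have "{y :: 'i \<Rightarrow>\<^sub>0 nat. keys y \<subseteq> K \<and> total y + D = t} = {}" by auto
  moreover have "poly (simplex_poly (card K) D) (of_nat t) = 0"
  proof -
    have "D - t \<in> {1..<card K}" "of_nat (D - t) - of_nat D + of_nat t = (0 :: rat)"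
      using False t by (auto simp: of_nat_diff)
    then have "(\<Prod>j=1..<card K. of_nat j - of_nat D + of_nat t :: rat) = 0"
      by (intro prod_zero) auto
    then show ?thesis using False t by (simp add: simplex_poly_def poly_prod)
  qed
  ultimately show ?thesis by (metis card.empty of_nat_0)
qed

text \<open>If membership in the up-set \<open>U\<close> is detected by the truncation \<open>min q m\<close>, then \<open>U\<close> is the disjoint
  union, over the truncations \<open>w\<close> of its points, of the cells of points with truncation \<open>w\<close> (a
  Stanley decomposition of a monomial ideal). The cell of \<open>w\<close> is \<open>w\<close> plus all vectors in the
  variables where \<open>w\<close> reaches \<open>m\<close>. Every other variable lowers the total of \<open>w\<close> by at least \<open>1\<close>
  against that of \<open>m\<close> and costs the polynomial of the cell one zero, so the counts of all cells are
  polynomial from the same degree \<open>total m - n\<close> on. Only the cell of \<open>m\<close> has all \<open>n + 1\<close> variables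
  free, and it alone contributes to the coefficient of degree \<open>n\<close>. The shift \<open>h\<close> absorbs the degree
  of the residue class in which \<open>U\<close> will live.\<close>

lemma card_upset_eventually_poly:
  fixes U :: "('i \<Rightarrow>\<^sub>0 nat) set"
  assumes I: "finite I" "card I = Suc n"
    and U: "\<And>q. q \<in> U \<Longrightarrow> keys q \<subseteq> I"
    and up: "\<And>q x. q \<in> U \<Longrightarrow> keys x \<subseteq> I \<Longrightarrow> q + x \<in> U"
    and ne: "U \<noteq> {}"
    and m: "keys m \<subseteq> I"
    and trunc: "\<And>q. q \<in> U \<Longrightarrow> vec_of I (\<lambda>i. min (lookup q i) (lookup m i)) \<in> U"
  shows "\<exists>p :: rat poly. degree p \<le> n \<and> coeff p n = 1 / fact n \<and>
    (\<forall>t. t + n \<ge> total m + h \<longrightarrow> of_nat (card {q \<in> U. total q + h = t}) = poly p (of_nat t))"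
proof -
  define W where "W = {w \<in> U. \<forall>i. lookup w i \<le> lookup m i}"
  define K where "K w = {i \<in> I. lookup w i = lookup m i}" for w
  define C where "C w t = {q. \<exists>y. q = w + y \<and> keys y \<subseteq> K w \<and> total y + (total w + h) = t}" for w t
  define p where "p = (\<Sum>w\<in>W. simplex_poly (card (K w)) (total w + h))"
  have finK: "finite (K w)" for w using I by (simp add: K_def)
  have KI: "K w \<subseteq> I" for w by (auto simp: K_def)
  have totW: "total w + (Suc n - card (K w)) \<le> total m" if "w \<in> W" for w
  proof -
    have "lookup w i + (if i \<in> K w then 0 else 1) \<le> lookup m i" if "i \<in> I" for i
      using \<open>w \<in> W\<close> that by (auto simp: W_def K_def Suc_le_eq le_neq_implies_less)
    then have "(\<Sum>i\<in>I. lookup w i + (if i \<in> K w then 0 else 1)) \<le> (\<Sum>i\<in>I. lookup m i)"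
      by (rule sum_mono)
    moreover have "(\<Sum>i\<in>I. if i \<in> K w then 0 else 1) = card (I - K w)"
      using I by (simp add: sum.If_cases Diff_eq)
    moreover have "card (I - K w) = Suc n - card (K w)"
      using I KI by (simp add: card_Diff_subset finK)
    moreover have "keys w \<subseteq> I" using that U by (simp add: W_def)
    ultimately show ?thesis
      using I m by (simp add: total_eq_sum[of I] sum.distrib)
  qed
  have "W \<subseteq> (\<Union>s\<le>total m. {y. keys y \<subseteq> I \<and> total y = s})"
    using totW U by (fastforce simp: W_def)
  then have finW: "finite W"
    using finite_vectors_total[OF I(1)] by (meson finite_UN finite_atMost finite_subset)
  have mW: "m \<in> W"
  proof -
    obtain q where q: "q \<in> U" using ne by blast
    then have "vec_of I (\<lambda>i. min (lookup (q + m) i) (lookup m i)) \<in> U"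
      using up trunc m by blast
    moreover have "vec_of I (\<lambda>i. min (lookup (q + m) i) (lookup m i)) = m"
      using I lookup_outside[OF m] by (intro poly_mapping_eqI) (auto simp: lookup_vec_of lookup_add)
    ultimately show ?thesis by (simp add: W_def)
  qed
  have Km: "K m = I" by (auto simp: K_def)
  (* the truncation of a point tells which cell contains it, so the cells are disjoint *)
  have trunc_C: "vec_of I (\<lambda>i. min (lookup q i) (lookup m i)) = w" if qC: "q \<in> C w t" and "w \<in> W" for q w t
  proof (rule vec_eqI[of _ I])
    show "keys (vec_of I (\<lambda>i. min (lookup q i) (lookup m i))) \<subseteq> I" "keys w \<subseteq> I"
      using keys_vec_of[OF I(1)] that U by (auto simp: W_def)
    obtain y where y: "q = w + y" "keys y \<subseteq> K w"
      using qC by (auto simp: C_def)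
    fix i assume i: "i \<in> I"
    have wm: "lookup w i \<le> lookup m i" using that by (simp add: W_def)
    have "min (lookup w i + lookup y i) (lookup m i) = lookup w i"
    proof (cases "i \<in> K w")
      case True
      then show ?thesis by (simp add: K_def)
    next
      case False
      then show ?thesis using wm lookup_outside[OF y(2)] by simp
    qed
    then show "lookup (vec_of I (\<lambda>i. min (lookup q i) (lookup m i))) i = lookup w i"
      using i I by (simp add: lookup_vec_of lookup_add y(1))
  qed
  have cells: "{q \<in> U. total q + h = t} = (\<Union>w\<in>W. C w t)" for t
  proof (intro equalityI subsetI)
    fix q assume q: "q \<in> {q \<in> U. total q + h = t}"
    let ?w = "vec_of I (\<lambda>i. min (lookup q i) (lookup m i))"
    let ?y = "vec_of I (\<lambda>i. lookup q i - lookup m i)"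
    have kq: "keys q \<subseteq> I" using q U by blast
    have eq: "q = ?w + ?y"
      using I lookup_outside[OF kq] by (intro poly_mapping_eqI) (auto simp: lookup_vec_of lookup_add)
    have "?w \<in> W" using q trunc m I by (auto simp: W_def lookup_vec_of)
    moreover have "keys ?y \<subseteq> K ?w"
      using I by (auto simp: in_keys_iff lookup_vec_of K_def split: if_splits)
    moreover have "total ?y + (total ?w + h) = t"
      using q arg_cong[OF eq, of total] by (simp add: total_add)
    ultimately show "q \<in> (\<Union>w\<in>W. C w t)" using eq unfolding C_def by blast
  next
    fix q assume "q \<in> (\<Union>w\<in>W. C w t)"
    then obtain w y where "w \<in> U" "q = w + y" "keys y \<subseteq> K w" "total y + (total w + h) = t"
      by (auto simp: C_def W_def)
    then show "q \<in> {q \<in> U. total q + h = t}"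
      using up[of w y] KI[of w] by (auto simp: total_add)
  qed
  have C_image: "C w t = (\<lambda>y. w + y) ` {y. keys y \<subseteq> K w \<and> total y + (total w + h) = t}" for w t
    by (auto simp: C_def)
  have finC: "finite (C w t)" for w t
  proof -
    have "{y. keys y \<subseteq> K w \<and> total y + (total w + h) = t} \<subseteq> {y. keys y \<subseteq> K w \<and> total y = t - (total w + h)}"
      by auto
    then show ?thesis
      unfolding C_image using finite_vectors_total[OF finK] finite_subset by blast
  qed
  have "of_nat (card {q \<in> U. total q + h = t}) = poly p (of_nat t)" if t: "t + n \<ge> total m + h" for t
  proof -
    have "card {q \<in> U. total q + h = t} = (\<Sum>w\<in>W. card (C w t))"
      unfolding cells
    proof (rule card_UN_disjoint[OF finW])
      show "\<forall>w\<in>W. finite (C w t)" using finC by blast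
      show "\<forall>w\<in>W. \<forall>w'\<in>W. w \<noteq> w' \<longrightarrow> C w t \<inter> C w' t = {}"
        using trunc_C by blast
    qed
    moreover have "of_nat (card (C w t)) = poly (simplex_poly (card (K w)) (total w + h)) (of_nat t)"
      if "w \<in> W" for w
    proof -
      have "card (C w t) = card {y. keys y \<subseteq> K w \<and> total y + (total w + h) = t}"
        unfolding C_image by (intro card_image inj_onI) simp
      moreover have "card (K w) \<le> Suc n" using card_mono[OF I(1) KI] I(2) by simp
      then have "total w + h < t + card (K w)"
        using totW[OF that] t by linarith
      ultimately show ?thesis by (simp add: card_vectors_shifted[OF finK])
    qed
    ultimately show ?thesis by (simp add: p_def poly_sum)
  qed
  moreover have deg: "degree (simplex_poly (card (K w)) D) \<le> n" for w D
    using degree_simplex_poly[of "card (K w)" D] card_mono[OF I(1) KI, of w] I(2) by linarith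
  then have "degree p \<le> n"
    unfolding p_def by (intro degree_sum_le finW) auto
  moreover have "coeff p n = 1 / fact n"
  proof -
    have "coeff (simplex_poly (card (K w)) (total w + h)) n = 0" if "w \<in> W - {m}" for w
    proof -
      have "K w \<noteq> I"
      proof
        assume "K w = I"
        then have "w = m"
          using that U m by (intro vec_eqI[of _ I]) (auto simp: W_def K_def)
        then show False using that by simp
      qed
      then have "card (K w) < Suc n"
        using psubset_card_mono[of I "K w"] KI[of w] I by (simp add: psubset_eq)
      then show ?thesis
        using degree_simplex_poly[of "card (K w)" "total w + h"]
        by (cases "card (K w) = 0") (simp_all add: simplex_poly_def[of 0] coeff_eq_0)
    qed
    then have "coeff p n = coeff (simplex_poly (card (K m)) (total m + h)) n"
      unfolding p_def coeff_sum by (simp add: sum.remove[OF finW mW])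
    then show ?thesis by (simp add: Km I(2) coeff_simplex_poly)
  qed
  ultimately show ?thesis by (intro exI[of _ p]) simp
qed


section \<open>Sumsets of a set containing the vertices of a simplex\<close>

lemma sumset_eq_sum_list: "sumset t A = {sum_list xs |xs. length xs = t \<and> set xs \<subseteq> A}"
proof (intro equalityI subsetI)
  fix u assume "u \<in> sumset t A"
  then obtain a where a: "u = (\<Sum>i<t. a i)" "\<forall>i<t. a i \<in> A"
    by (auto simp: sumset_def)
  then have "u = sum_list (map a [0..<t])"
    by (simp add: interv_sum_list_conv_sum_set_nat atLeast0LessThan)
  then show "u \<in> {sum_list xs |xs. length xs = t \<and> set xs \<subseteq> A}"
    using a(2) by (intro CollectI exI[of _ "map a [0..<t]"]) auto
next
  fix u assume "u \<in> {sum_list xs |xs. length xs = t \<and> set xs \<subseteq> A}"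
  then obtain xs where xs: "u = sum_list xs" "length xs = t" "set xs \<subseteq> A"
    by blast
  then show "u \<in> sumset t A"
    unfolding sumset_def using nth_mem[of _ xs]
    by (intro CollectI exI[of _ "\<lambda>i. xs ! i"]) (auto simp: sum_list_sum_nth atLeast0LessThan)
qed

lemma lookup_sum_list: "lookup (sum_list xs) i = (\<Sum>a\<leftarrow>xs. lookup a i)"
  by (induction xs) (auto simp: lookup_add)

lemma sum_list_extract_copies:
  fixes xs :: "'a::comm_monoid_add list"
  assumes "k \<le> count_list xs a"
  shows "\<exists>ys. set ys \<subseteq> set xs \<and> sum_list xs = sum_list (replicate k a) + sum_list ys"
  using assms
proof (induction xs arbitrary: k)
  case Nil
  then show ?case by simp
next
  case (Cons b xs)
  show ?case
  proof (cases k)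
    case 0
    then show ?thesis by (intro exI[of _ "b # xs"]) simp
  next
    case (Suc k')
    show ?thesis
    proof (cases "b = a")
      case True
      then obtain ys where "set ys \<subseteq> set xs" "sum_list xs = sum_list (replicate k' a) + sum_list ys"
        using Cons.IH[of k'] Cons.prems Suc by auto
      then show ?thesis
        using True Suc by (intro exI[of _ ys]) (auto simp: add.assoc)
    next
      case False
      then obtain ys where "set ys \<subseteq> set xs" "sum_list xs = sum_list (replicate k a) + sum_list ys"
        using Cons.IH[of k] Cons.prems by auto
      then show ?thesis
        by (intro exI[of _ "b # ys"]) (auto simp: add.left_commute)
    qed
  qed
qed

lemma eq_single_of_total:
  assumes "total a = lookup a i"
  shows "a = Poly_Mapping.single i (lookup a i)"
proof -
  have *: "a = Poly_Mapping.single i (lookup a i) + (a - Poly_Mapping.single i (lookup a i))"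
    by (intro poly_mapping_eqI) (simp add: lookup_add lookup_minus lookup_single when_def)
  then have "total (a - Poly_Mapping.single i (lookup a i)) = 0"
    using assms total_add[of "Poly_Mapping.single i (lookup a i)" "a - Poly_Mapping.single i (lookup a i)"]
    by simp
  then show ?thesis using * by (simp add: total_eq_0_iff)
qed

text \<open>The homogenized form of the problem: \<open>H\<close> is a finite set of vectors of total \<open>d\<close> in \<open>n + 1\<close>
  variables that contains the vertices of the simplex of all such vectors. The semigroup \<open>S\<close> that
  \<open>H\<close> generates is graded by \<open>total u div d\<close>, and its part of degree \<open>t\<close> is the \<open>t\<close>-fold
  sumset.\<close>

locale simplicial_set =
  fixes I :: "'i set" and n d :: nat and H :: "('i \<Rightarrow>\<^sub>0 nat) set"
  assumes finite_I: "finite I" and card_I: "card I = Suc n" and d_pos: "0 < d"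
    and finite_H: "finite H" and keys_H: "a \<in> H \<Longrightarrow> keys a \<subseteq> I"
    and total_H: "a \<in> H \<Longrightarrow> total a = d"
    and vertex_H: "i \<in> I \<Longrightarrow> Poly_Mapping.single i d \<in> H"
begin

definition S :: "('i \<Rightarrow>\<^sub>0 nat) set" where
  "S = {sum_list xs |xs. set xs \<subseteq> H}"

definition nonvertices :: "('i \<Rightarrow>\<^sub>0 nat) set" where
  "nonvertices = H - (\<lambda>i. Poly_Mapping.single i d) ` I"

definition divisible :: "('i \<Rightarrow>\<^sub>0 nat) \<Rightarrow> bool" where
  "divisible x \<longleftrightarrow> keys x \<subseteq> I \<and> (\<forall>i. d dvd lookup x i)"

text \<open>The vectors that generate \<open>S\<close> as a module over the free semigroup of divisible vectors, which is
  generated by the vertices.\<close>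

definition minimal :: "('i \<Rightarrow>\<^sub>0 nat) \<Rightarrow> bool" where
  "minimal u \<longleftrightarrow> u \<in> S \<and> \<not> (\<exists>v\<in>S. \<exists>x. divisible x \<and> x \<noteq> 0 \<and> u = v + x)"

definition residue :: "('i \<Rightarrow>\<^sub>0 nat) \<Rightarrow> 'i \<Rightarrow>\<^sub>0 nat" where
  "residue u = vec_of I (\<lambda>i. lookup u i mod d)"

text \<open>The vector with coordinatewise remainders \<open>r\<close> and quotients \<open>q\<close> modulo \<open>d\<close>, if the entries of
  \<open>r\<close> are less than \<open>d\<close>.\<close>

definition lift :: "('i \<Rightarrow>\<^sub>0 nat) \<Rightarrow> ('i \<Rightarrow>\<^sub>0 nat) \<Rightarrow> 'i \<Rightarrow>\<^sub>0 nat" where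
  "lift r q = vec_of I (\<lambda>i. lookup r i + d * lookup q i)"

definition residues :: "('i \<Rightarrow>\<^sub>0 nat) set" where
  "residues = residue ` S"

text \<open>The difference between the degree of \<open>lift r q\<close> and the total of \<open>q\<close>; the division is exact for
  residues of elements of \<open>S\<close>.\<close>

definition height :: "('i \<Rightarrow>\<^sub>0 nat) \<Rightarrow> nat" where
  "height r = total r div d"

lemma zero_in_S: "0 \<in> S"
  unfolding S_def by (intro CollectI exI[of _ "[]"]) simp

lemma H_in_S: "a \<in> H \<Longrightarrow> a \<in> S"
  unfolding S_def by (intro CollectI exI[of _ "[a]"]) simp

lemma S_add: "u \<in> S \<Longrightarrow> v \<in> S \<Longrightarrow> u + v \<in> S"
proof -
  assume "u \<in> S" "v \<in> S"
  then obtain xs ys where "u = sum_list xs" "set xs \<subseteq> H" "v = sum_list ys" "set ys \<subseteq> H"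
    by (auto simp: S_def)
  then show ?thesis
    unfolding S_def by (intro CollectI exI[of _ "xs @ ys"]) auto
qed

lemma keys_sum_list_H: "set xs \<subseteq> H \<Longrightarrow> keys (sum_list xs) \<subseteq> I"
  by (induction xs) (simp_all add: keys_add_subset keys_H)

lemma keys_S: "u \<in> S \<Longrightarrow> keys u \<subseteq> I"
  using keys_sum_list_H by (auto simp: S_def)

lemma total_sum_list_H: "set xs \<subseteq> H \<Longrightarrow> total (sum_list xs) = d * length xs"
  by (induction xs) (auto simp: total_add total_H)

lemma sumset_H: "sumset t H = {u \<in> S. total u = d * t}"
proof -
  have "set xs \<subseteq> H \<Longrightarrow> total (sum_list xs) = d * t \<longleftrightarrow> length xs = t" for xs
    using d_pos by (simp add: total_sum_list_H)
  then show ?thesis by (auto simp: sumset_eq_sum_list S_def)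
qed

lemma divisible_in_S: "divisible x \<Longrightarrow> x \<in> S"
proof (induction "total x" arbitrary: x rule: less_induct)
  case less
  show ?case
  proof (cases "x = 0")
    case True
    then show ?thesis by (simp add: zero_in_S)
  next
    case False
    then obtain i where i: "lookup x i \<noteq> 0"
      by (metis lookup_zero poly_mapping_eqI)
    then have iI: "i \<in> I" and di: "d \<le> lookup x i"
      using less.prems by (auto simp: divisible_def in_keys_iff dvd_imp_le)
    let ?s = "Poly_Mapping.single i d"
    have eq: "x = ?s + (x - ?s)"
      using di by (intro poly_mapping_eqI) (auto simp: lookup_add lookup_minus lookup_single when_def)
    have "keys (x - ?s) \<subseteq> I"
      using less.prems by (auto simp: divisible_def in_keys_iff lookup_minus)
    moreover have "d dvd lookup (x - ?s) j" for j
      using less.prems by (auto simp: divisible_def lookup_minus lookup_single when_def)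
    moreover have "total (x - ?s) < total x"
      using arg_cong[OF eq, of total] d_pos by (simp add: total_add)
    ultimately have "x - ?s \<in> S"
      using less.hyps by (simp add: divisible_def)
    then show ?thesis
      using eq S_add[OF H_in_S[OF vertex_H[OF iI]]] by metis
  qed
qed

lemma minimal_below:
  assumes "u \<in> S"
  shows "\<exists>v x. minimal v \<and> divisible x \<and> u = v + x"
  using assms
proof (induction "total u" arbitrary: u rule: less_induct)
  case less
  show ?case
  proof (cases "minimal u")
    case True
    then show ?thesis
      by (intro exI[of _ u] exI[of _ 0]) (simp add: divisible_def)
  next
    case False
    then obtain v x where v: "v \<in> S" "divisible x" "x \<noteq> 0" "u = v + x"
      using less.prems by (auto simp: minimal_def)
    then have "total v < total u"
      using total_eq_0_iff[of x] by (simp add: total_add)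
    then obtain v' x' where v': "minimal v'" "divisible x'" "v = v' + x'"
      using less.hyps v(1) by blast
    then have "u = v' + (x' + x)" using v by (simp add: add.assoc)
    moreover have "divisible (x' + x)"
      using v v' by (simp add: divisible_def lookup_add keys_add_subset)
    ultimately show ?thesis using v' by blast
  qed
qed

text \<open>Replacing the summand \<open>w\<close> of a minimal element by a smaller congruent \<open>v\<close> in \<open>S\<close> would change it by
  a nonzero divisible vector. Both bounds on the phase transition come from this kind of exchange.\<close>

lemma minimal_no_congruent_below:
  assumes u: "minimal (w + z)" and S: "v \<in> S" "w \<in> S" "z \<in> S"
    and le: "\<And>i. lookup v i \<le> lookup w i" and cong: "\<And>i. lookup v i mod d = lookup w i mod d"
  shows "v = w"
proof (rule ccontr)
  assume "v \<noteq> w"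
  have w: "w = v + (w - v)"
    using le by (intro poly_mapping_eqI) (simp add: lookup_add lookup_minus)
  then have "w - v \<noteq> 0" using \<open>v \<noteq> w\<close> by (metis add.right_neutral)
  moreover have "keys (w - v) \<subseteq> I"
    using keys_S[OF S(2)] by (auto simp: in_keys_iff lookup_minus)
  moreover have "d dvd lookup (w - v) i" for i
    using mod_eq_dvd_iff_nat[OF le[of i], of d] cong[of i] by (simp add: lookup_minus)
  ultimately have "w - v \<noteq> 0" "divisible (w - v)"
    by (simp_all add: divisible_def)
  moreover have "w + z = (v + z) + (w - v)"
    by (subst w) (simp add: algebra_simps)
  ultimately show False
    using u S_add[OF S(1,3)] unfolding minimal_def by blast
qed

lemma minimal_sum_list_nonvertices:
  assumes "minimal (sum_list xs)" "set xs \<subseteq> H"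
  shows "set xs \<subseteq> nonvertices"
proof
  fix a assume a: "a \<in> set xs"
  have False if "i \<in> I" "a = Poly_Mapping.single i d" for i
  proof -
    have "sum_list xs = sum_list (remove1 a xs) + a"
      using sum_list_map_remove1[OF a, of id] by (simp add: add.commute)
    moreover have "sum_list (remove1 a xs) \<in> S"
      using assms(2) set_remove1_subset[of a xs] by (auto simp: S_def)
    moreover have "divisible a"
      using that by (auto simp: divisible_def lookup_single when_def)
    moreover have "a \<noteq> 0"
      using d_pos that total_single[of i d] by (metis total_zero less_irrefl)
    ultimately show False
      using assms(1) by (auto simp: minimal_def)
  qed
  then show "a \<in> nonvertices"
    using a assms(2) by (auto simp: nonvertices_def)
qed

text \<open>The sum of \<open>d\<close> equal vectors is divisible, so no element occurs \<open>d\<close> times.\<close>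

lemma minimal_count_less:
  assumes "minimal (sum_list xs)" "set xs \<subseteq> H" "a \<in> H"
  shows "count_list xs a < d"
proof (rule ccontr)
  assume "\<not> count_list xs a < d"
  then obtain ys where ys: "set ys \<subseteq> set xs" "sum_list xs = sum_list (replicate d a) + sum_list ys"
    using sum_list_extract_copies[of d xs a] by auto
  have "divisible (sum_list (replicate d a))"
    unfolding divisible_def
    by (auto simp: lookup_sum_list map_replicate_const sum_list_replicate
        intro!: keys_sum_list_H[THEN subsetD] assms(3))
  moreover have "sum_list (replicate d a) \<noteq> 0"
    using total_sum_list_H[of "replicate d a"] assms(3) d_pos by auto
  moreover have "sum_list ys \<in> S"
    using ys assms(2) by (auto simp: S_def)
  ultimately show False
    using assms(1) ys(2) unfolding minimal_def by (metis add.commute)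
qed

lemma minimal_lookup_le:
  assumes "minimal u"
  shows "lookup u i \<le> (d - 1) * (\<Sum>a\<in>nonvertices. lookup a i)"
proof -
  obtain xs where xs: "u = sum_list xs" "set xs \<subseteq> H"
    using assms by (auto simp: minimal_def S_def)
  have fin: "finite nonvertices" using finite_H by (simp add: nonvertices_def)
  have sub: "set xs \<subseteq> nonvertices"
    using minimal_sum_list_nonvertices assms xs by simp
  have "lookup u i = (\<Sum>a\<in>set xs. count_list xs a * lookup a i)"
    by (simp add: xs(1) lookup_sum_list sum_list_map_eq_sum_count)
  also have "\<dots> \<le> (\<Sum>a\<in>set xs. (d - 1) * lookup a i)"
  proof (intro sum_mono mult_right_mono)
    fix a assume "a \<in> set xs"
    then have "count_list xs a < d"
      using minimal_count_less[of xs a] assms xs by auto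
    then show "count_list xs a \<le> d - 1" by simp
  qed simp
  also have "\<dots> \<le> (\<Sum>a\<in>nonvertices. (d - 1) * lookup a i)"
    by (rule sum_mono2[OF fin sub]) simp
  finally show ?thesis by (simp add: sum_distrib_left)
qed

text \<open>A vector of total \<open>d\<close> with an entry \<open>d\<close> is a vertex. Hence every other element of \<open>H\<close> is its own
  residue, and distinct ones are incongruent modulo \<open>d\<close>.\<close>

lemma lookup_nonvertex_less:
  assumes "a \<in> nonvertices"
  shows "lookup a i < d"
proof (rule ccontr)
  assume "\<not> lookup a i < d"
  moreover have a: "a \<in> H" "total a = d"
    using assms total_H by (auto simp: nonvertices_def)
  ultimately have l: "lookup a i = d"
    using lookup_le_total[of a i] by simp
  then have "a = Poly_Mapping.single i d"
    using eq_single_of_total[of a i] a by simp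
  moreover have "i \<in> I"
    using l d_pos keys_H[OF a(1)] by (auto simp: in_keys_iff)
  ultimately show False
    using assms by (auto simp: nonvertices_def)
qed

lemma lookup_residue: "keys u \<subseteq> I \<Longrightarrow> lookup (residue u) i = lookup u i mod d"
  using lookup_outside[of u I i] by (simp add: residue_def lookup_vec_of finite_I)

lemma keys_residue: "keys (residue u) \<subseteq> I"
  by (simp add: residue_def keys_vec_of finite_I)

lemma keys_lift: "keys (lift r q) \<subseteq> I"
  by (simp add: lift_def keys_vec_of finite_I)

lemma lookup_lift:
  "keys r \<subseteq> I \<Longrightarrow> keys q \<subseteq> I \<Longrightarrow> lookup (lift r q) i = lookup r i + d * lookup q i"
  using lookup_outside[of r I i] lookup_outside[of q I i] by (simp add: lift_def lookup_vec_of finite_I)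

lemma residueD:
  assumes "r \<in> residues"
  shows "keys r \<subseteq> I" "lookup r i < d" "d dvd total r"
proof -
  obtain u where u: "u \<in> S" "r = residue u" using assms by (auto simp: residues_def)
  show "keys r \<subseteq> I" using u keys_residue by simp
  show "lookup r i < d" using u d_pos by (simp add: lookup_residue keys_S)
  have "total u = (\<Sum>i\<in>I. lookup u i div d * d + lookup u i mod d)"
    using u keys_S total_eq_sum[OF finite_I] by (simp only: div_mult_mod_eq)
  also have "\<dots> = (\<Sum>i\<in>I. lookup u i div d * d) + (\<Sum>i\<in>I. lookup u i mod d)"
    by (rule sum.distrib)
  also have "\<dots> = d * (\<Sum>i\<in>I. lookup u i div d) + total r"
    by (simp add: u(2) residue_def total_vec_of finite_I sum_distrib_left mult.commute)
  finally have "total u = d * (\<Sum>i\<in>I. lookup u i div d) + total r" .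
  moreover have "d dvd total u"
    using u total_sum_list_H by (auto simp: S_def)
  ultimately show "d dvd total r"
    by (metis dvd_add_right_iff dvd_triv_left)
qed

lemma finite_residues: "finite residues"
proof (rule finite_subset)
  show "residues \<subseteq> vec_of I ` (I \<rightarrow>\<^sub>E {..<d})"
  proof
    fix r assume r: "r \<in> residues"
    have "vec_of I (restrict (lookup r) I) = r"
      using lookup_outside[OF residueD(1)[OF r]] finite_I
      by (intro poly_mapping_eqI) (auto simp: lookup_vec_of)
    moreover have "restrict (lookup r) I \<in> I \<rightarrow>\<^sub>E {..<d}"
      using residueD(2)[OF r] by auto
    ultimately show "r \<in> vec_of I ` (I \<rightarrow>\<^sub>E {..<d})" by (metis imageI)
  qed
  show "finite (vec_of I ` (I \<rightarrow>\<^sub>E {..<d}))"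
    using finite_I by (intro finite_imageI finite_PiE) auto
qed

lemma residue_small: "keys u \<subseteq> I \<Longrightarrow> (\<And>i. lookup u i < d) \<Longrightarrow> residue u = u"
  by (intro poly_mapping_eqI) (simp add: lookup_residue)

lemma small_residues: "insert 0 nonvertices \<subseteq> residues"
proof -
  have "residue a = a" "a \<in> S" if "a \<in> insert 0 nonvertices" for a
    using that lookup_nonvertex_less[of a] d_pos H_in_S[of a] keys_H[of a] zero_in_S
    by (auto intro!: residue_small simp: nonvertices_def)
  then show ?thesis by (metis imageI residues_def subsetI)
qed

text \<open>A pigeonhole argument on residues. By the exchange lemma the partial sums of a minimal element
  have distinct residues, and a partial sum of at least two terms is not congruent to \<open>0\<close> or to a
  nonvertex: these have entries less than \<open>d\<close>, hence would lie below it. So besides the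
  \<open>1 + card nonvertices\<close> residues of \<open>0\<close> and of the nonvertices there are \<open>length xs - 1\<close> more.\<close>

lemma minimal_length_le:
  assumes u: "minimal (sum_list xs)" and xs: "set xs \<subseteq> H"
  shows "length xs + card nonvertices \<le> card residues"
proof -
  define w where "w j = sum_list (take j xs)" for j
  have wS: "w j \<in> S" and zS: "sum_list (drop j xs) \<in> S" for j
    using xs set_take_subset[of j xs] set_drop_subset[of j xs] unfolding w_def S_def by blast+
  have split: "minimal (w j + sum_list (drop j xs))" for j
    using u by (simp add: w_def flip: sum_list_append)
  have tot: "total (w j) = d * j" if "j \<le> length xs" for j
    using that xs set_take_subset[of j xs] by (simp add: w_def total_sum_list_H)
  have fin: "finite nonvertices" using finite_H by (simp add: nonvertices_def)
  have w_mono: "lookup (w i) k \<le> lookup (w j) k" if "i \<le> j" for i j k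
  proof -
    have "take j xs = take i xs @ drop i (take j xs)"
      using that by (metis append_take_drop_id min.absorb1 take_take)
    then have "w j = w i + sum_list (drop i (take j xs))"
      unfolding w_def by (metis sum_list_append)
    then show ?thesis by (simp add: lookup_add)
  qed
  (* the exchange lemma for partial sums, phrased with residues *)
  have key: "v = w j" if "v \<in> S" "residue v = residue (w j)" "\<And>k. lookup v k \<le> lookup (w j) k" for v j
  proof (rule minimal_no_congruent_below[OF split that(1) wS zS that(3)])
    show "lookup v i mod d = lookup (w j) i mod d" for i
      using arg_cong[OF that(2), of "\<lambda>x. lookup x i"] keys_S[OF that(1)] keys_S[OF wS]
      by (simp add: lookup_residue)
  qed
  have inj: "inj_on (\<lambda>j. residue (w j)) {2..length xs}"
  proof (rule linorder_inj_onI)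
    fix i j assume ij: "i < j" "i \<in> {2..length xs}" "j \<in> {2..length xs}"
    show "residue (w i) \<noteq> residue (w j)"
    proof
      assume "residue (w i) = residue (w j)"
      then have "w i = w j" using key wS w_mono ij by (simp add: less_imp_le)
      then show False using tot[of i] tot[of j] ij d_pos by simp
    qed
  qed auto
  have "a \<noteq> residue (w j)" if a: "a \<in> insert 0 nonvertices" and j: "j \<in> {2..length xs}" for a j
  proof
    assume eq: "a = residue (w j)"
    have aS: "a \<in> S"
      using a zero_in_S H_in_S by (auto simp: nonvertices_def)
    have "residue a = a"
      using a lookup_nonvertex_less[of a] d_pos keys_H[of a] by (auto intro!: residue_small simp: nonvertices_def)
    moreover have "lookup a k \<le> lookup (w j) k" for k
      by (simp add: eq lookup_residue keys_S[OF wS])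
    ultimately have "a = w j" using key aS eq by simp
    moreover have "total a \<le> d"
      using a total_H by (auto simp: nonvertices_def)
    ultimately show False using tot[of j] j d_pos by simp
  qed
  then have "insert 0 nonvertices \<inter> (\<lambda>j. residue (w j)) ` {2..length xs} = {}"
    by blast
  then have "card (insert 0 nonvertices \<union> (\<lambda>j. residue (w j)) ` {2..length xs})
      = card (insert 0 nonvertices) + (length xs - 1)"
    using fin inj by (subst card_Un_disjoint) (auto simp: card_image)
  moreover have "insert 0 nonvertices \<union> (\<lambda>j. residue (w j)) ` {2..length xs} \<subseteq> residues"
    using small_residues wS by (auto simp: residues_def)
  then have "card (insert 0 nonvertices \<union> (\<lambda>j. residue (w j)) ` {2..length xs}) \<le> card residues"
    by (rule card_mono[OF finite_residues])
  moreover have "0 \<notin> nonvertices"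
    using total_H d_pos by (auto simp: nonvertices_def dest: total_H)
  then have "card (insert 0 nonvertices) = Suc (card nonvertices)"
    using fin by simp
  ultimately show ?thesis by linarith
qed


lemma lift_residue:
  assumes "keys u \<subseteq> I"
  shows "lift (residue u) (vec_of I (\<lambda>i. lookup u i div d)) = u"
proof (rule poly_mapping_eqI)
  fix i
  show "lookup (lift (residue u) (vec_of I (\<lambda>i. lookup u i div d))) i = lookup u i"
    using lookup_outside[OF assms, of i] assms
    by (simp add: lookup_lift keys_residue keys_vec_of finite_I lookup_residue lookup_vec_of)
qed

lemma residue_lift:
  assumes "r \<in> residues" "keys q \<subseteq> I"
  shows "residue (lift r q) = r"
  using assms residueD[OF assms(1)]
  by (intro poly_mapping_eqI) (simp add: lookup_residue keys_lift lookup_lift)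

lemma total_lift:
  assumes "r \<in> residues" "keys q \<subseteq> I"
  shows "total (lift r q) = d * (total q + height r)"
proof -
  have "total (lift r q) = (\<Sum>i\<in>I. lookup r i + d * lookup q i)"
    by (simp add: lift_def total_vec_of finite_I)
  also have "\<dots> = total r + d * total q"
    using residueD(1)[OF assms(1)] assms(2)
    by (simp add: sum.distrib sum_distrib_left total_eq_sum[OF finite_I])
  also have "total r = d * height r"
    using residueD(3)[OF assms(1)] by (simp add: height_def)
  finally show ?thesis by (simp add: algebra_simps)
qed

lemma lift_add:
  assumes "keys r \<subseteq> I" "keys q \<subseteq> I" "keys x \<subseteq> I"
  shows "lift r (q + x) = lift r q + lift 0 x"
  using assms
  by (intro poly_mapping_eqI) (simp add: lookup_lift lookup_add keys_add_subset algebra_simps)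

lemma divisible_lift: "keys x \<subseteq> I \<Longrightarrow> divisible (lift 0 x)"
  by (simp add: divisible_def keys_lift lookup_lift)

text \<open>Within a residue class the minimal elements generate the class as an up-set of quotient vectors.\<close>

lemma minimal_lift_below:
  assumes r: "r \<in> residues" and q: "keys q \<subseteq> I" and S: "lift r q \<in> S"
  shows "\<exists>q'. keys q' \<subseteq> I \<and> minimal (lift r q') \<and> (\<forall>i. lookup q' i \<le> lookup q i)"
proof -
  obtain v x where v: "minimal v" "divisible x" "lift r q = v + x"
    using minimal_below[OF S] by blast
  have kv: "keys v \<subseteq> I" using v keys_S by (simp add: minimal_def)
  have "lookup (lift r q) i mod d = lookup v i mod d" for i
  proof -
    have "d dvd lookup x i" using v(2) by (simp add: divisible_def)
    then obtain k where "lookup x i = d * k" by (rule dvdE)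
    then show ?thesis by (simp add: v(3) lookup_add)
  qed
  then have "residue v = residue (lift r q)"
    by (simp add: residue_def)
  then have rv: "residue v = r" by (simp add: residue_lift r q)
  define q' where "q' = vec_of I (\<lambda>i. lookup v i div d)"
  have kq': "keys q' \<subseteq> I" by (simp add: q'_def keys_vec_of finite_I)
  have lq': "lift r q' = v" using lift_residue[OF kv] by (simp add: rv q'_def)
  have "lookup q' i \<le> lookup q i" for i
  proof -
    have "lookup (lift r q') i \<le> lookup (lift r q) i"
      by (simp add: v(3) lq' lookup_add)
    then show ?thesis
      using d_pos by (simp add: lookup_lift residueD(1)[OF r] q kq')
  qed
  then show ?thesis using kq' lq' v(1) by blast
qed

lemma minimal_lift_exists:
  assumes "r \<in> residues"
  shows "\<exists>q. keys q \<subseteq> I \<and> minimal (lift r q)"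
proof -
  obtain u where u: "u \<in> S" "r = residue u" using assms by (auto simp: residues_def)
  then have "lift r (vec_of I (\<lambda>i. lookup u i div d)) \<in> S"
    using lift_residue[OF keys_S[OF u(1)]] by simp
  then show ?thesis
    using minimal_lift_below[OF assms keys_vec_of[OF finite_I]] by blast
qed

lemma sumset_class_card:
  assumes r: "r \<in> residues"
  shows "card {u \<in> sumset t H. residue u = r}
    = card {q \<in> {q. keys q \<subseteq> I \<and> lift r q \<in> S}. total q + height r = t}" (is "_ = card ?Q")
proof -
  have "inj_on (lift r) ?Q"
  proof (rule inj_onI)
    fix q q' assume q: "q \<in> ?Q" "q' \<in> ?Q" "lift r q = lift r q'"
    have "lookup q i = lookup q' i" for i
      using arg_cong[OF q(3), of "\<lambda>u. lookup u i"] q(1,2) d_pos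
      by (simp add: lookup_lift residueD(1)[OF r])
    then show "q = q'" by (intro poly_mapping_eqI)
  qed
  moreover have "lift r ` ?Q = {u \<in> sumset t H. residue u = r}"
  proof (intro equalityI subsetI)
    fix u assume "u \<in> lift r ` ?Q"
    then show "u \<in> {u \<in> sumset t H. residue u = r}"
      using r by (auto simp: sumset_H total_lift residue_lift)
  next
    fix u assume "u \<in> {u \<in> sumset t H. residue u = r}"
    then have u: "u \<in> S" "total u = d * t" "residue u = r"
      by (auto simp: sumset_H)
    let ?q = "vec_of I (\<lambda>i. lookup u i div d)"
    have l: "lift r ?q = u" using lift_residue[OF keys_S[OF u(1)]] u(3) by simp
    have k: "keys ?q \<subseteq> I" by (rule keys_vec_of[OF finite_I])
    have "total ?q + height r = t"
      using total_lift[OF r k] l u(2) d_pos by simp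
    moreover have "lift r ?q \<in> S" unfolding l by (rule u(1))
    ultimately have "?q \<in> ?Q" using k by blast
    then show "u \<in> lift r ` ?Q" by (rule rev_image_eqI) (rule l[symmetric])
  qed
  ultimately show ?thesis using card_image by fastforce
qed

text \<open>Split the sumset by residues. In each class the quotient vectors form an up-set, and a bound \<open>m\<close> on
  its minimal elements makes truncation at \<open>m\<close> detect membership. Every class contributes
  \<open>1 / fact n\<close> to the leading coefficient, so the degree of the monomial variety is the number of
  residues.\<close>

lemma card_sumset_eventually_poly:
  assumes bound: "\<And>r. r \<in> residues \<Longrightarrow> \<exists>m. keys m \<subseteq> I \<and>
      (\<forall>q. keys q \<subseteq> I \<and> minimal (lift r q) \<longrightarrow> (\<forall>i. lookup q i \<le> lookup m i)) \<and>
      total m + height r \<le> N + n"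
  shows "\<exists>p :: rat poly. degree p = n \<and> lead_coeff p = of_nat (card residues) / fact n \<and>
    (\<forall>t\<ge>N. of_nat (card (sumset t H)) = poly p (of_nat t))"
proof -
  have "\<exists>p :: rat poly. degree p \<le> n \<and> coeff p n = 1 / fact n \<and>
      (\<forall>t\<ge>N. of_nat (card {u \<in> sumset t H. residue u = r}) = poly p (of_nat t))"
    if r: "r \<in> residues" for r
  proof -
    define U where "U = {q. keys q \<subseteq> I \<and> lift r q \<in> S}"
    obtain m where m: "keys m \<subseteq> I" "total m + height r \<le> N + n"
      and le: "\<And>q i. keys q \<subseteq> I \<Longrightarrow> minimal (lift r q) \<Longrightarrow> lookup q i \<le> lookup m i"
      using bound[OF r] by blast
    have kr: "keys r \<subseteq> I" by (rule residueD(1)[OF r])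
    have up: "q + x \<in> U" if "q \<in> U" "keys x \<subseteq> I" for q x
      using that S_add[OF _ divisible_in_S[OF divisible_lift]]
      by (simp add: U_def keys_add_subset lift_add kr)
    have ne: "U \<noteq> {}"
      using minimal_lift_exists[OF r] by (auto simp: U_def minimal_def)
    have trunc: "vec_of I (\<lambda>i. min (lookup q i) (lookup m i)) \<in> U" if q: "q \<in> U" for q
    proof -
      obtain q' where q': "keys q' \<subseteq> I" "minimal (lift r q')" "\<And>i. lookup q' i \<le> lookup q i"
        using minimal_lift_below[OF r, of q] q by (auto simp: U_def)
      let ?y = "vec_of I (\<lambda>i. min (lookup q i) (lookup m i) - lookup q' i)"
      have "vec_of I (\<lambda>i. min (lookup q i) (lookup m i)) = q' + ?y"
        using q'(3) le[OF q'(1,2)] lookup_outside[OF q'(1)]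
        by (intro poly_mapping_eqI) (simp add: lookup_vec_of lookup_add finite_I)
      moreover have "q' \<in> U" using q' by (simp add: U_def minimal_def)
      ultimately show ?thesis
        using up[OF _ keys_vec_of[OF finite_I]] by simp
    qed
    have "\<exists>p :: rat poly. degree p \<le> n \<and> coeff p n = 1 / fact n \<and>
      (\<forall>t. t + n \<ge> total m + height r \<longrightarrow>
        of_nat (card {q \<in> U. total q + height r = t}) = poly p (of_nat t))"
      by (rule card_upset_eventually_poly[OF finite_I card_I _ up ne m(1) trunc]) (simp_all add: U_def)
    then obtain p :: "rat poly" where p: "degree p \<le> n" "coeff p n = 1 / fact n"
      and eq: "\<And>t. t + n \<ge> total m + height r \<Longrightarrow>
        of_nat (card {q \<in> U. total q + height r = t}) = poly p (of_nat t)"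
      by blast
    have "of_nat (card {u \<in> sumset t H. residue u = r}) = poly p (of_nat t)" if "t \<ge> N" for t
      using eq[of t] that m(2) by (simp add: sumset_class_card[OF r] U_def)
    then show ?thesis using p by (intro exI[of _ p]) simp
  qed
  then have "\<forall>r\<in>residues. \<exists>p :: rat poly. degree p \<le> n \<and> coeff p n = 1 / fact n \<and>
      (\<forall>t\<ge>N. of_nat (card {u \<in> sumset t H. residue u = r}) = poly p (of_nat t))"
    by (intro ballI)
  from bchoice[OF this] obtain P :: "('i \<Rightarrow>\<^sub>0 nat) \<Rightarrow> rat poly" where P: "\<And>r. r \<in> residues \<Longrightarrow> degree (P r) \<le> n"
    "\<And>r. r \<in> residues \<Longrightarrow> coeff (P r) n = 1 / fact n"
    "\<And>r t. r \<in> residues \<Longrightarrow> t \<ge> N \<Longrightarrow>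
      of_nat (card {u \<in> sumset t H. residue u = r}) = poly (P r) (of_nat t)"
    by auto
  define p where "p = (\<Sum>r\<in>residues. P r)"
  have c: "coeff p n = of_nat (card residues) / fact n"
    by (simp add: p_def coeff_sum P(2))
  moreover have "residues \<noteq> {}" using small_residues by blast
  ultimately have "coeff p n \<noteq> 0" using finite_residues by simp
  moreover have "degree p \<le> n"
    unfolding p_def by (intro degree_sum_le finite_residues P(1))
  ultimately have deg: "degree p = n" by (simp add: le_antisym le_degree)
  have "of_nat (card (sumset t H)) = poly p (of_nat t)" if "t \<ge> N" for t
  proof -
    have fin: "finite (sumset t H)"
    proof (rule finite_subset[OF _ finite_vectors_total[OF finite_I, of "d * t"]])
      show "sumset t H \<subseteq> {y. keys y \<subseteq> I \<and> total y = d * t}"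
        using keys_S by (auto simp: sumset_H)
    qed
    have "sumset t H = (\<Union>r\<in>residues. {u \<in> sumset t H. residue u = r})"
      by (auto simp: sumset_H residues_def)
    then have "card (sumset t H) = card (\<Union>r\<in>residues. {u \<in> sumset t H. residue u = r})"
      by simp
    also have "\<dots> = (\<Sum>r\<in>residues. card {u \<in> sumset t H. residue u = r})"
      using fin by (intro card_UN_disjoint finite_residues) auto
    finally show ?thesis
      using P(3) that by (simp add: p_def poly_sum)
  qed
  then show ?thesis using deg c by (intro exI[of _ p]) simp
qed

text \<open>In a minimal element every nonvertex occurs at most \<open>d - 1\<close> times and no vertex occurs. So all
  minimal elements lie coordinatewise below \<open>d - 1\<close> times the sum of all nonvertices, a vector of
  degree \<open>(d - 1) * card nonvertices\<close>, and rounding it down inside a residue class only lowers the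
  degree.\<close>

lemma card_sumset_poly_multiplicity_bound:
  "\<exists>p :: rat poly. degree p = n \<and> lead_coeff p = of_nat (card residues) / fact n \<and>
    (\<forall>t\<ge>(d - 1) * card nonvertices. of_nat (card (sumset t H)) = poly p (of_nat t))"
proof (rule card_sumset_eventually_poly)
  fix r assume r: "r \<in> residues"
  define B where "B i = (d - 1) * (\<Sum>a\<in>nonvertices. lookup a i)" for i
  define m where "m = vec_of I (\<lambda>i. (B i - lookup r i) div d)"
  have kr: "keys r \<subseteq> I" by (rule residueD(1)[OF r])
  have km: "keys m \<subseteq> I" by (simp add: m_def keys_vec_of finite_I)
  have le: "lookup r i + d * lookup q i \<le> B i" if "keys q \<subseteq> I" "minimal (lift r q)" for q i
    using minimal_lookup_le[OF that(2), of i] that(1) by (simp add: B_def lookup_lift kr)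
  obtain q0 where q0: "keys q0 \<subseteq> I" "minimal (lift r q0)"
    using minimal_lift_exists[OF r] by blast
  have "total (lift r m) = (\<Sum>i\<in>I. lookup r i + d * lookup m i)"
    by (simp add: lift_def total_vec_of finite_I)
  also have "\<dots> \<le> (\<Sum>i\<in>I. B i)"
  proof (rule sum_mono)
    fix i assume "i \<in> I"
    then have "d * lookup m i \<le> B i - lookup r i"
      by (simp add: m_def lookup_vec_of finite_I)
    then show "lookup r i + d * lookup m i \<le> B i"
      using le[OF q0, of i] by linarith
  qed
  also have "\<dots> = (d - 1) * (\<Sum>a\<in>nonvertices. \<Sum>i\<in>I. lookup a i)"
    by (simp add: B_def sum_distrib_left sum.swap[of _ I])
  also have "(\<Sum>a\<in>nonvertices. \<Sum>i\<in>I. lookup a i) = (\<Sum>a\<in>nonvertices. d)"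
  proof (rule sum.cong[OF refl])
    fix a assume "a \<in> nonvertices"
    then have "a \<in> H" by (simp add: nonvertices_def)
    then show "(\<Sum>i\<in>I. lookup a i) = d"
      using total_eq_sum[OF finite_I keys_H] total_H by simp
  qed
  finally have "d * (total m + height r) \<le> d * ((d - 1) * card nonvertices)"
    by (simp add: total_lift[OF r km] mult.commute mult.left_commute)
  then have "total m + height r \<le> (d - 1) * card nonvertices"
    using d_pos by simp
  moreover have "lookup q i \<le> lookup m i" if "keys q \<subseteq> I" "minimal (lift r q)" for q i
  proof (cases "i \<in> I")
    case True
    have "lookup q i * d \<le> B i - lookup r i"
      using le[OF that, of i] by (simp add: mult.commute)
    then have "lookup q i \<le> (B i - lookup r i) div d"
      using d_pos by (simp add: less_eq_div_iff_mult_less_eq)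
    then show ?thesis using True by (simp add: m_def lookup_vec_of finite_I)
  next
    case False
    then show ?thesis using lookup_outside[OF that(1), of i] by simp
  qed
  ultimately show "\<exists>m. keys m \<subseteq> I \<and>
      (\<forall>q. keys q \<subseteq> I \<and> minimal (lift r q) \<longrightarrow> (\<forall>i. lookup q i \<le> lookup m i)) \<and>
      total m + height r \<le> (d - 1) * card nonvertices + n"
    using km by (intro exI[of _ m]) auto
qed

text \<open>A minimal element has degree at most \<open>\<rho> = card residues - card nonvertices\<close>, so its quotient vector
  has total at most \<open>\<rho> - height r\<close>, and the constant vector with this entry bounds all of them. Its
  degree including the shift is \<open>Suc n * \<rho> - n * height r\<close>. A nonzero class has height at least
  \<open>1\<close>; this saves \<open>n\<close>, and counting by cells saves another \<open>n\<close>. The class of \<open>0\<close> consists of the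
  divisible vectors, where \<open>0\<close> is the only minimal element.\<close>

lemma card_sumset_poly_length_bound:
  assumes N: "Suc n * (card residues - card nonvertices) \<le> N + 2 * n"
  shows "\<exists>p :: rat poly. degree p = n \<and> lead_coeff p = of_nat (card residues) / fact n \<and>
    (\<forall>t\<ge>N. of_nat (card (sumset t H)) = poly p (of_nat t))"
proof (rule card_sumset_eventually_poly)
  fix r assume r: "r \<in> residues"
  define \<rho> where "\<rho> = card residues - card nonvertices"
  have kr: "keys r \<subseteq> I" by (rule residueD(1)[OF r])
  have le: "total q + height r \<le> \<rho>" if q: "keys q \<subseteq> I" "minimal (lift r q)" for q
  proof -
    obtain xs where xs: "lift r q = sum_list xs" "set xs \<subseteq> H"
      using q(2) by (auto simp: minimal_def S_def)
    then have "d * (total q + height r) = d * length xs"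
      using total_lift[OF r q(1)] total_sum_list_H by metis
    moreover have "length xs \<le> \<rho>"
      using minimal_length_le[of xs] xs q(2) by (simp add: \<rho>_def)
    ultimately show ?thesis using d_pos by simp
  qed
  obtain q0 where q0: "keys q0 \<subseteq> I" "minimal (lift r q0)"
    using minimal_lift_exists[OF r] by blast
  show "\<exists>m. keys m \<subseteq> I \<and>
      (\<forall>q. keys q \<subseteq> I \<and> minimal (lift r q) \<longrightarrow> (\<forall>i. lookup q i \<le> lookup m i)) \<and>
      total m + height r \<le> N + n"
  proof (cases "r = 0")
    case True
    have "q = 0" if "keys q \<subseteq> I" "minimal (lift r q)" for q
    proof -
      have "lift r q = 0"
        using that(2) zero_in_S divisible_lift[OF that(1)] True unfolding minimal_def
        by (metis add.left_neutral)
      then have "lookup q i = 0" for i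
        using lookup_lift[OF kr that(1), of i] True d_pos by simp
      then show ?thesis by (intro poly_mapping_eqI) simp
    qed
    then have "\<forall>q. keys q \<subseteq> I \<and> minimal (lift r q) \<longrightarrow> (\<forall>i. lookup q i \<le> lookup (0 :: 'i \<Rightarrow>\<^sub>0 nat) i)"
      by fastforce
    then show ?thesis
      using True by (intro exI[of _ 0]) (simp add: height_def)
  next
    case False
    define h where "h = height r"
    have "total r \<noteq> 0" using False by (simp add: total_eq_0_iff)
    then have h: "1 \<le> h"
      using residueD(3)[OF r] by (auto simp: h_def height_def elim!: dvdE)
    have h\<rho>: "h \<le> \<rho>" using le[OF q0] by (simp add: h_def)
    define m where "m = vec_of I (\<lambda>_. \<rho> - h)"
    have "keys m \<subseteq> I" by (simp add: m_def keys_vec_of finite_I)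
    moreover have "lookup q i \<le> lookup m i" if "keys q \<subseteq> I" "minimal (lift r q)" for q i
    proof (cases "i \<in> I")
      case True
      have "lookup q i \<le> \<rho> - h"
        using le[OF that] lookup_le_total[of q i] by (simp add: h_def)
      then show ?thesis using True by (simp add: m_def lookup_vec_of finite_I)
    next
      case False
      then show ?thesis using lookup_outside[OF that(1), of i] by simp
    qed
    moreover have "total m + h \<le> N + n"
    proof -
      obtain k where k: "\<rho> = h + k" using h\<rho> le_Suc_ex by blast
      have "total m = k + n * k"
        by (simp add: m_def total_vec_of finite_I card_I k)
      moreover have "(h + k) + (n * h + n * k) \<le> N + 2 * n"
        using N unfolding \<rho>_def[symmetric] k by (simp add: algebra_simps)
      moreover have "n \<le> n * h" using h by simp
      ultimately show ?thesis by linarith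
    qed
    ultimately show ?thesis
      by (intro exI[of _ m]) (simp add: h_def)
  qed
qed

end


section \<open>Linear independence of monomials\<close>

text \<open>Dedekind's theorem on the independence of distinct characters. Applied to monomials on the torus,
  it shows that a polynomial function determines its coefficients.\<close>

lemma characters_independent:
  fixes \<chi> :: "'w \<Rightarrow> 'x \<Rightarrow> 'k::field"
  assumes "finite W"
    and closed: "\<And>x y. x \<in> X \<Longrightarrow> y \<in> X \<Longrightarrow> pr x y \<in> X" and one: "e \<in> X"
    and mult: "\<And>w x y. w \<in> W \<Longrightarrow> x \<in> X \<Longrightarrow> y \<in> X \<Longrightarrow> \<chi> w (pr x y) = \<chi> w x * \<chi> w y"
    and unit: "\<And>w. w \<in> W \<Longrightarrow> \<chi> w e = 1"
    and distinct: "\<And>w w'. w \<in> W \<Longrightarrow> w' \<in> W \<Longrightarrow> w \<noteq> w' \<Longrightarrow> \<exists>y\<in>X. \<chi> w y \<noteq> \<chi> w' y"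
    and zero: "\<And>x. x \<in> X \<Longrightarrow> (\<Sum>w\<in>W. c w * \<chi> w x) = 0"
  shows "\<forall>w\<in>W. c w = 0"
  using assms(1) mult unit distinct zero
proof (induction W arbitrary: c rule: finite_induct)
  case empty
  then show ?case by simp
next
  case (insert v W)
  have c0: "c w = 0" if "w \<in> W" for w
  proof -
    have "w \<noteq> v" using that insert.hyps by auto
    then obtain y where y: "y \<in> X" "\<chi> w y \<noteq> \<chi> v y"
      using insert.prems(3)[of w v] \<open>w \<in> W\<close> by auto
    have "\<forall>w\<in>W. c w * (\<chi> w y - \<chi> v y) = 0"
    proof (rule insert.IH)
      fix x assume x: "x \<in> X"
      (* subtracting \<chi> v y times the relation at x from the relation at pr x y eliminates v *)
      have "(\<Sum>w\<in>W. c w * (\<chi> w y - \<chi> v y) * \<chi> w x)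
          = (\<Sum>w\<in>insert v W. c w * (\<chi> w y - \<chi> v y) * \<chi> w x)"
        using insert.hyps by simp
      also have "\<dots> = (\<Sum>w\<in>insert v W. c w * \<chi> w (pr x y) - \<chi> v y * (c w * \<chi> w x))"
        by (rule sum.cong[OF refl]) (simp add: insert.prems(1) x y(1) algebra_simps)
      also have "\<dots> = (\<Sum>w\<in>insert v W. c w * \<chi> w (pr x y)) - \<chi> v y * (\<Sum>w\<in>insert v W. c w * \<chi> w x)"
        by (simp only: sum_subtractf sum_distrib_left)
      also have "\<dots> = 0"
        using insert.prems(4) closed x y by (simp del: sum.insert)
      finally show "(\<Sum>w\<in>W. c w * (\<chi> w y - \<chi> v y) * \<chi> w x) = 0" .
    qed (use insert.prems(1,2,3) in auto)
    then show ?thesis using \<open>w \<in> W\<close> y(2) by auto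
  qed
  moreover have "c v = 0"
    using insert.prems(4)[OF one] insert.hyps insert.prems(2) c0 by simp
  ultimately show ?case by simp
qed

definition monomial :: "'i set \<Rightarrow> ('i \<Rightarrow>\<^sub>0 nat) \<Rightarrow> ('i \<Rightarrow> 'k::field) \<Rightarrow> 'k" where
  "monomial I w x = (\<Prod>i\<in>I. x i ^ lookup w i)"

lemma monomials_independent:
  fixes c :: "('i \<Rightarrow>\<^sub>0 nat) \<Rightarrow> 'k::field_char_0"
  assumes I: "finite I" and W: "finite W" "\<And>w. w \<in> W \<Longrightarrow> keys w \<subseteq> I"
    and zero: "\<And>x. \<forall>i. x i \<noteq> 0 \<Longrightarrow> (\<Sum>w\<in>W. c w * monomial I w x) = 0"
    and w: "w \<in> W"
  shows "c w = 0"
proof -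
  have "\<forall>w\<in>W. c w = 0"
  proof (rule characters_independent[where X = "{x :: 'i \<Rightarrow> 'k. \<forall>i. x i \<noteq> 0}" and pr = "\<lambda>x y i. x i * y i"
      and e = "\<lambda>_. 1" and \<chi> = "monomial I", OF W(1)])
    fix w w' assume ww: "w \<in> W" "w' \<in> W" "w \<noteq> w'"
    then obtain i where i: "i \<in> I" "lookup w i \<noteq> lookup w' i"
      using W(2) vec_eqI[of w I w'] by blast
    define y :: "'i \<Rightarrow> 'k" where "y j = (if j = i then 2 else 1)" for j
    have y_val: "monomial I v y = 2 ^ lookup v i" for v
    proof -
      have "monomial I v y = (\<Prod>j\<in>I. if j = i then 2 ^ lookup v i else 1)"
        unfolding monomial_def by (rule prod.cong) (auto simp: y_def)
      then show ?thesis using i I by simp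
    qed
    have "(2 :: 'k) ^ lookup w i \<noteq> 2 ^ lookup w' i"
    proof
      assume "(2 :: 'k) ^ lookup w i = 2 ^ lookup w' i"
      then have "of_nat (2 ^ lookup w i) = (of_nat (2 ^ lookup w' i) :: 'k)" by simp
      then have "(2 :: nat) ^ lookup w i = 2 ^ lookup w' i" using of_nat_eq_iff by blast
      then show False using i by simp
    qed
    then have "monomial I w y \<noteq> monomial I w' y" unfolding y_val .
    moreover have "y \<in> {x. \<forall>i. x i \<noteq> 0}" by (simp add: y_def)
    ultimately show "\<exists>y\<in>{x :: 'i \<Rightarrow> 'k. \<forall>i. x i \<noteq> 0}. monomial I w y \<noteq> monomial I w' y"
      by blast
  qed (use zero in \<open>auto simp: monomial_def power_mult_distrib prod.distrib\<close>)
  then show ?thesis using w by blast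
qed


section \<open>Dimensions of spaces of forms\<close>

lemma lookup_sum_scale:
  "lookup (\<Sum>m\<in>N. mpoly_scale (c m) (b m)) k = (\<Sum>m\<in>N. c m * lookup (b m) k)"
  by (simp add: lookup_sum)

text \<open>The coefficients at the exponents in \<open>N\<close> are coordinates on \<open>V\<close>, with \<open>b\<close> as the dual basis.\<close>

lemma dim_eq_card_dual:
  fixes V :: "('i, 'k::field) mpoly set"
  assumes N: "finite N" and b: "\<And>m. m \<in> N \<Longrightarrow> b m \<in> V"
    and dual: "\<And>m m'. m \<in> N \<Longrightarrow> m' \<in> N \<Longrightarrow> lookup (b m) m' = (if m = m' then 1 else 0)"
    and expand: "\<And>f. f \<in> V \<Longrightarrow> f = (\<Sum>m\<in>N. mpoly_scale (lookup f m) (b m))"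
  shows "vector_space.dim mpoly_scale V = card N"
proof -
  interpret vector_space "mpoly_scale :: 'k \<Rightarrow> ('i, 'k) mpoly \<Rightarrow> ('i, 'k) mpoly"
    by (rule vector_space_mpoly_scale)
  have inj: "inj_on b N"
    by (rule inj_onI) (metis dual one_neq_zero)
  have "independent (b ` N)"
  proof (rule independent_if_scalars_zero)
    show "finite (b ` N)" using N by simp
    fix g x assume z: "(\<Sum>x\<in>b ` N. mpoly_scale (g x) x) = 0" and "x \<in> b ` N"
    then obtain m where m: "m \<in> N" "x = b m" by blast
    have "(\<Sum>m'\<in>N. mpoly_scale (g (b m')) (b m')) = 0"
      using z by (simp add: sum.reindex[OF inj])
    then have "lookup (\<Sum>m'\<in>N. mpoly_scale (g (b m')) (b m')) m = 0" by simp
    moreover have "lookup (\<Sum>m'\<in>N. mpoly_scale (g (b m')) (b m')) m = (\<Sum>m'\<in>N. if m' = m then g (b m') else 0)"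
      unfolding lookup_sum_scale by (rule sum.cong[OF refl]) (simp add: dual m)
    ultimately show "g x = 0" using m N by simp
  qed
  moreover have "span (b ` N) = span V"
  proof (rule span_eq[THEN iffD2], intro conjI)
    show "b ` N \<subseteq> span V" using b span_base by blast
    show "V \<subseteq> span (b ` N)"
    proof
      fix f assume "f \<in> V"
      have "(\<Sum>m\<in>N. mpoly_scale (lookup f m) (b m)) \<in> span (b ` N)"
        by (intro span_sum span_scale span_base) auto
      then show "f \<in> span (b ` N)" using expand[OF \<open>f \<in> V\<close>] by simp
    qed
  qed
  ultimately show ?thesis
    using dim_eq_card card_image[OF inj] by metis
qed

lemma dim_forms:
  fixes M :: "('i \<Rightarrow>\<^sub>0 nat) set"
  assumes "finite M"
  shows "vector_space.dim mpoly_scale {f :: ('i, 'k::field) mpoly. keys f \<subseteq> M} = card M"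
proof (rule dim_eq_card_dual[where b = "\<lambda>m. Poly_Mapping.single m 1", OF assms])
  fix f :: "('i, 'k) mpoly" assume f: "f \<in> {f. keys f \<subseteq> M}"
  show "f = (\<Sum>m\<in>M. mpoly_scale (lookup f m) (Poly_Mapping.single m 1))"
  proof (rule poly_mapping_eqI)
    fix k
    have "(\<Sum>m\<in>M. lookup f m * lookup (Poly_Mapping.single m 1) k) = (\<Sum>m\<in>M. if m = k then lookup f m else 0)"
      by (rule sum.cong[OF refl]) (simp add: lookup_single when_def)
    then show "lookup f k = lookup (\<Sum>m\<in>M. mpoly_scale (lookup f m) (Poly_Mapping.single m 1)) k"
      using f assms by (auto simp: lookup_sum_scale in_keys_iff)
  qed
qed (auto simp: lookup_single when_def)

text \<open>Choose a representative of every fiber of \<open>\<Phi>\<close>. The differences between each other monomial and the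
  representative of its fiber form a basis, so one dimension is lost per fiber.\<close>

lemma dim_fiberwise_zero_forms:
  fixes M :: "('i \<Rightarrow>\<^sub>0 nat) set" and \<Phi> :: "('i \<Rightarrow>\<^sub>0 nat) \<Rightarrow> 'w"
  assumes M: "finite M"
  shows "vector_space.dim mpoly_scale
      {f :: ('i, 'k::field) mpoly. keys f \<subseteq> M \<and> (\<forall>w. (\<Sum>m\<in>{m \<in> M. \<Phi> m = w}. lookup f m) = 0)}
    = card M - card (\<Phi> ` M)" (is "vector_space.dim _ ?V = _")
proof -
  define s where "s w = (SOME m. m \<in> M \<and> \<Phi> m = w)" for w
  have s: "s (\<Phi> m) \<in> M" "\<Phi> (s (\<Phi> m)) = \<Phi> m" if "m \<in> M" for m
    using someI[of "\<lambda>m'. m' \<in> M \<and> \<Phi> m' = \<Phi> m" m] that by (auto simp: s_def)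
  define T where "T = s ` \<Phi> ` M"
  have T: "T \<subseteq> M" using s by (auto simp: T_def)
  have sT: "s (\<Phi> m) = m" if "m \<in> T" for m
    using that s by (auto simp: T_def)
  define N where "N = M - T"
  define b :: "('i \<Rightarrow>\<^sub>0 nat) \<Rightarrow> ('i, 'k) mpoly" where
    "b m = Poly_Mapping.single m 1 - Poly_Mapping.single (s (\<Phi> m)) 1" for m
  have lb: "lookup (b m) k = (if m = k then 1 else 0) - (if s (\<Phi> m) = k then 1 else 0)" for m k
    by (simp add: b_def lookup_minus lookup_single when_def)
  have "vector_space.dim mpoly_scale ?V = card N"
  proof (rule dim_eq_card_dual[where b = b])
    show "finite N" using M by (simp add: N_def)
  next
    fix m assume m: "m \<in> N"
    then have mM: "m \<in> M" by (simp add: N_def)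
    have "keys (b m) \<subseteq> M"
      using mM s[OF mM] by (auto simp: in_keys_iff lb split: if_splits)
    moreover have "(\<Sum>k\<in>{k \<in> M. \<Phi> k = w}. lookup (b m) k) = 0" for w
      using M mM s[OF mM] by (simp add: lb sum_subtractf)
    ultimately show "b m \<in> ?V" by simp
  next
    fix m m' assume mm: "m \<in> N" "m' \<in> N"
    have "s (\<Phi> m) \<noteq> m'"
      using mm by (auto simp: N_def T_def)
    then show "lookup (b m) m' = (if m = m' then 1 else 0)" by (simp add: lb)
  next
    fix f assume f: "f \<in> ?V"
    show "f = (\<Sum>m\<in>N. mpoly_scale (lookup f m) (b m))"
    proof (rule poly_mapping_eqI)
      fix k
      have "(\<Sum>m\<in>N. lookup f m * lookup (b m) k)
          = (\<Sum>m\<in>N. if m = k then lookup f m else 0) - (\<Sum>m\<in>N. if s (\<Phi> m) = k then lookup f m else 0)"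
        unfolding sum_subtractf[symmetric] by (rule sum.cong[OF refl]) (simp add: lb algebra_simps)
      moreover have "(\<Sum>m\<in>N. if m = k then lookup f m else 0) = (if k \<in> N then lookup f k else 0)"
        using M by (simp add: N_def)
      moreover have "(\<Sum>m\<in>N. if s (\<Phi> m) = k then lookup f m else 0) = (\<Sum>m\<in>{m \<in> N. s (\<Phi> m) = k}. lookup f m)"
        using M by (intro sum.inter_filter[symmetric]) (simp add: N_def)
      moreover have "(\<Sum>m\<in>{m \<in> N. s (\<Phi> m) = k}. lookup f m) = - lookup f k" if k: "k \<in> T"
      proof -
        have kM: "k \<in> M" using k T by blast
        have "{m \<in> M. \<Phi> m = \<Phi> k} = insert k {m \<in> N. s (\<Phi> m) = k}"
        proof (intro equalityI subsetI)
          fix m assume m: "m \<in> {m \<in> M. \<Phi> m = \<Phi> k}"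
          then have "s (\<Phi> m) = k" using sT[OF k] by simp
          then show "m \<in> insert k {m \<in> N. s (\<Phi> m) = k}"
            using m sT[of m] by (auto simp: N_def)
        next
          fix m assume "m \<in> insert k {m \<in> N. s (\<Phi> m) = k}"
          then show "m \<in> {m \<in> M. \<Phi> m = \<Phi> k}"
            using kM s(2)[of m] by (auto simp: N_def)
        qed
        moreover have "k \<notin> {m \<in> N. s (\<Phi> m) = k}" using k by (simp add: N_def)
        moreover have "finite {m \<in> N. s (\<Phi> m) = k}" using M by (simp add: N_def)
        ultimately have "(\<Sum>m\<in>{m \<in> M. \<Phi> m = \<Phi> k}. lookup f m)
            = lookup f k + (\<Sum>m\<in>{m \<in> N. s (\<Phi> m) = k}. lookup f m)"
          by simp
        then show ?thesis using f by (simp add: eq_neg_iff_add_eq_0 add.commute)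
      qed
      moreover have "(\<Sum>m\<in>{m \<in> N. s (\<Phi> m) = k}. lookup f m) = 0" if "k \<notin> T"
      proof -
        have "{m \<in> N. s (\<Phi> m) = k} = {}" using that by (auto simp: N_def T_def)
        then show ?thesis by (simp only: sum.empty)
      qed
      moreover have "lookup f k = 0" if "k \<notin> M"
        using f that by (auto simp: in_keys_iff)
      ultimately show "lookup f k = lookup (\<Sum>m\<in>N. mpoly_scale (lookup f m) (b m)) k"
        using T by (cases "k \<in> T"; cases "k \<in> M") (auto simp: lookup_sum_scale N_def)
    qed
  qed
  moreover have "card T = card (\<Phi> ` M)"
    unfolding T_def
  proof (rule card_image, rule inj_onI)
    fix v w assume vw: "v \<in> \<Phi> ` M" "w \<in> \<Phi> ` M" "s v = s w"
    have "\<Phi> (s u) = u" if "u \<in> \<Phi> ` M" for u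
      using that s(2) by auto
    then show "v = w" using vw by metis
  qed
  moreover have "card N = card M - card T"
    using M T by (simp add: N_def card_Diff_subset finite_subset)
  ultimately show ?thesis by simp
qed


section \<open>The Hilbert function of the monomial variety\<close>

definition homogenize :: "nat \<Rightarrow> (nat \<Rightarrow>\<^sub>0 nat) \<Rightarrow> nat \<Rightarrow>\<^sub>0 nat" where
  "homogenize d a = a + Poly_Mapping.single 0 (d - total a)"

text \<open>Substituting the coordinate monomials of the parametrization into the monomial with exponent \<open>m\<close>
  gives the monomial in \<open>x\<^sub>0, \<dots>, x\<^sub>n\<close> with exponent \<open>exponent n A m\<close>.\<close>

definition exponent ::
    "nat \<Rightarrow> (nat \<Rightarrow>\<^sub>0 nat) set \<Rightarrow> ((nat \<Rightarrow>\<^sub>0 nat) \<Rightarrow>\<^sub>0 nat) \<Rightarrow> nat \<Rightarrow>\<^sub>0 nat" where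
  "exponent n A m = vec_of {0..n} (\<lambda>i. \<Sum>a\<in>A. lookup m a * lookup (homogenize (max_total A) a) i)"

lemma total_le_max_total:
  assumes "finite A" "a \<in> A"
  shows "total a \<le> max_total A"
proof -
  have "\<forall>a\<in>A. total a \<le> Max (total ` A)" using assms by simp
  then have "\<forall>a\<in>A. total a \<le> max_total A" unfolding max_total_def by (rule LeastI)
  then show ?thesis using assms by blast
qed

lemma total_homogenize: "total a \<le> d \<Longrightarrow> total (homogenize d a) = d"
  by (simp add: homogenize_def total_add)

lemma keys_homogenize: "a \<in> nat_vectors n \<Longrightarrow> keys (homogenize d a) \<subseteq> {0..n}"
  unfolding homogenize_def
  by (rule keys_add_subset) (auto simp: nat_vectors_def)

lemma lookup_homogenize_pos: "0 < i \<Longrightarrow> lookup (homogenize d a) i = lookup a i"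
  by (simp add: homogenize_def lookup_add lookup_single)

lemma lookup_homogenize_0: "a \<in> nat_vectors n \<Longrightarrow> lookup (homogenize d a) 0 = d - total a"
  using lookup_outside[of a "{1..n}" 0] by (simp add: homogenize_def lookup_add nat_vectors_def)

lemma inj_on_homogenize: "inj_on (homogenize d) (nat_vectors n)"
proof (rule inj_onI)
  fix a b assume ab: "a \<in> nat_vectors n" "b \<in> nat_vectors n" "homogenize d a = homogenize d b"
  show "a = b"
  proof (rule vec_eqI[of _ "{1..n}"])
    show "lookup a i = lookup b i" if "i \<in> {1..n}" for i
      using that ab(3) lookup_homogenize_pos[of i d] by (metis atLeastAtMost_iff less_le_trans less_one)
  qed (use ab in \<open>auto simp: nat_vectors_def\<close>)
qed

lemma lookup_exponent:
  "lookup (exponent n A m) i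
    = (if i \<in> {0..n} then \<Sum>a\<in>A. lookup m a * lookup (homogenize (max_total A) a) i else 0)"
  by (simp add: exponent_def lookup_vec_of)

lemma keys_exponent: "keys (exponent n A m) \<subseteq> {0..n}"
  by (simp add: exponent_def keys_vec_of)

lemma exponent_add: "exponent n A (m + m') = exponent n A m + exponent n A m'"
  by (intro poly_mapping_eqI) (simp add: lookup_exponent lookup_add distrib_right sum.distrib)

lemma exponent_zero: "exponent n A 0 = 0"
  by (intro poly_mapping_eqI) (simp add: lookup_exponent)

lemma exponent_single:
  assumes "finite A" "A \<subseteq> nat_vectors n" "a \<in> A"
  shows "exponent n A (Poly_Mapping.single a 1) = homogenize (max_total A) a"
proof (rule poly_mapping_eqI)
  fix i
  have "(\<Sum>b\<in>A. lookup (Poly_Mapping.single a (1 :: nat)) b * lookup (homogenize (max_total A) b) i)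
      = (\<Sum>b\<in>A. if b = a then lookup (homogenize (max_total A) b) i else 0)"
    by (rule sum.cong[OF refl]) (simp add: lookup_single when_def)
  moreover have "lookup (homogenize (max_total A) a) i = 0" if "i \<notin> {0..n}"
    using lookup_outside[OF keys_homogenize] that assms(2,3) by blast
  ultimately show "lookup (exponent n A (Poly_Mapping.single a 1)) i = lookup (homogenize (max_total A) a) i"
    using assms by (auto simp: lookup_exponent)
qed

lemma sumset_image: "sumset t (f ` A) = {sum_list (map f xs) |xs. length xs = t \<and> set xs \<subseteq> A}"
proof -
  have "{ys. length ys = t \<and> set ys \<subseteq> f ` A} = map f ` {xs. length xs = t \<and> set xs \<subseteq> A}"
  proof (intro equalityI subsetI)
    fix ys assume ys: "ys \<in> {ys. length ys = t \<and> set ys \<subseteq> f ` A}"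
    then have "ys \<in> lists (f ` A)" by (auto simp: lists_eq_set)
    then have "ys \<in> map f ` lists A" by (simp only: lists_image)
    then obtain xs where "xs \<in> lists A" "ys = map f xs" by blast
    then show "ys \<in> map f ` {xs. length xs = t \<and> set xs \<subseteq> A}"
      using ys by (intro image_eqI[of _ _ xs]) (auto simp: lists_eq_set)
  qed (auto intro!: imageI)
  then show ?thesis
    by (simp add: sumset_eq_sum_list setcompr_eq_image image_image)
qed

lemma vectors_total_eq_sumset:
  "{m. keys m \<subseteq> A \<and> total m = t} = sumset t ((\<lambda>a. Poly_Mapping.single a (1 :: nat)) ` A)"
proof -
  define mu :: "'a list \<Rightarrow> 'a \<Rightarrow>\<^sub>0 nat" where "mu xs = sum_list (map (\<lambda>a. Poly_Mapping.single a 1) xs)" for xs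
  have "\<exists>xs. length xs = t \<and> set xs \<subseteq> A \<and> m = mu xs" if "keys m \<subseteq> A" "total m = t" for m t
    using that
  proof (induction t arbitrary: m)
    case 0
    then show ?case by (simp add: total_eq_0_iff mu_def)
  next
    case (Suc t)
    then have "m \<noteq> 0" by auto
    then obtain a where a: "lookup m a \<noteq> 0"
      by (metis lookup_zero poly_mapping_eqI)
    then have aA: "a \<in> A" using Suc.prems by (auto simp: in_keys_iff)
    let ?s = "Poly_Mapping.single a (1 :: nat)"
    have eq: "m = ?s + (m - ?s)"
      using a by (intro poly_mapping_eqI) (auto simp: lookup_add lookup_minus lookup_single when_def)
    have "keys (m - ?s) \<subseteq> A" using Suc.prems(1) by (auto simp: in_keys_iff lookup_minus)
    moreover have "total (m - ?s) = t"
      using arg_cong[OF eq, of total] Suc.prems(2) by (simp add: total_add)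
    ultimately obtain xs where xs: "length xs = t" "set xs \<subseteq> A" "m - ?s = mu xs"
      using Suc.IH by blast
    have "m = mu (a # xs)" using eq xs(3) by (simp add: mu_def)
    then show ?case using xs aA by (intro exI[of _ "a # xs"]) simp
  qed
  moreover have "total (mu xs) = length xs" for xs
    by (induction xs) (simp_all add: mu_def total_add)
  moreover have "set xs \<subseteq> A \<Longrightarrow> keys (mu xs) \<subseteq> A" for xs
    by (induction xs) (simp_all add: mu_def keys_add_subset)
  ultimately show ?thesis
    unfolding sumset_image mu_def[symmetric] by blast
qed

lemma exponent_image:
  assumes "finite A" "A \<subseteq> nat_vectors n"
  shows "exponent n A ` {m. keys m \<subseteq> A \<and> total m = t} = sumset t (homogenize (max_total A) ` A)"
proof -
  have "set xs \<subseteq> A \<Longrightarrow> exponent n A (sum_list (map (\<lambda>a. Poly_Mapping.single a 1) xs))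
      = sum_list (map (homogenize (max_total A)) xs)" for xs
    by (induction xs) (simp_all add: exponent_zero exponent_add exponent_single[OF assms] del: One_nat_def)
  then show ?thesis
    unfolding vectors_total_eq_sumset sumset_image setcompr_eq_image image_image
    by (intro image_cong) auto
qed

text \<open>Dropping coordinate \<open>0\<close> is additive and undoes homogenization. It is injective on the sumset of the
  homogenized set, because all totals there are equal and determine coordinate \<open>0\<close>.\<close>

lemma sumset_card_homogenize:
  assumes "finite A" "A \<subseteq> nat_vectors n"
  shows "card (sumset t (homogenize (max_total A) ` A)) = sumset_card A t"
proof -
  let ?h = "homogenize (max_total A)"
  define tail where "tail v = vec_of {1..n} (lookup v)" for v
  have tail_add: "tail (u + v) = tail u + tail v" for u v
    by (intro poly_mapping_eqI) (simp add: tail_def lookup_vec_of lookup_add)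
  have tail_h: "tail (?h a) = a" if "a \<in> A" for a
    using that assms(2) lookup_outside[of a "{1..n}"]
    by (intro poly_mapping_eqI) (auto simp: tail_def lookup_vec_of lookup_homogenize_pos nat_vectors_def)
  have tail_0: "tail 0 = 0"
    by (intro poly_mapping_eqI) (simp add: tail_def lookup_vec_of)
  have tail_sum: "set xs \<subseteq> A \<Longrightarrow> tail (sum_list (map ?h xs)) = sum_list xs" for xs
    by (induction xs) (simp_all add: tail_0 tail_add tail_h)
  have tot: "set xs \<subseteq> A \<Longrightarrow> total (sum_list (map ?h xs)) = max_total A * length xs" for xs
    by (induction xs) (use total_le_max_total[OF assms(1)] in \<open>simp_all add: total_add total_homogenize\<close>)
  have keys: "set xs \<subseteq> A \<Longrightarrow> keys (sum_list (map ?h xs)) \<subseteq> {0..n}" for xs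
    by (induction xs) (use assms(2) in \<open>simp_all add: keys_add_subset keys_homogenize subset_iff[of A]\<close>)
  have "tail ` sumset t (?h ` A) = sumset t A"
    unfolding sumset_image sumset_eq_sum_list[of t A] setcompr_eq_image image_image
    by (intro image_cong) (auto simp: tail_sum)
  moreover have "inj_on tail (sumset t (?h ` A))"
  proof (rule inj_onI)
    fix u v assume "u \<in> sumset t (?h ` A)" "v \<in> sumset t (?h ` A)" and tl: "tail u = tail v"
    then have k: "keys u \<subseteq> {0..n}" "keys v \<subseteq> {0..n}" and tt: "total u = total v"
      unfolding sumset_image using tot keys by auto
    have l: "lookup u i = lookup v i" if "i \<in> {1..n}" for i
      using arg_cong[OF tl, of "\<lambda>w. lookup w i"] that by (simp add: tail_def lookup_vec_of)
    have "total w = lookup w 0 + (\<Sum>i\<in>{1..n}. lookup w i)" if "keys w \<subseteq> {0..n}" for w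
      using total_eq_sum[OF _ that] by (simp add: sum.atLeast_Suc_atMost)
    then have "lookup u 0 = lookup v 0" using tt k l by simp
    then have "lookup u i = lookup v i" if "i \<in> {0..n}" for i
      using l that by (cases "i = 0") auto
    then show "u = v" using k vec_eqI by blast
  qed
  ultimately show ?thesis
    using card_image[of tail "sumset t (?h ` A)"] by (simp add: sumset_card_def)
qed

lemma monomial_coords_eq:
  assumes "A \<subseteq> nat_vectors n" "a \<in> A"
  shows "monomial_coords n A x a = monomial {0..n} (homogenize (max_total A) a) x"
proof -
  have "monomial {0..n} (homogenize (max_total A) a) x
      = x 0 ^ (max_total A - total a) * (\<Prod>i=1..n. x i ^ lookup (homogenize (max_total A) a) i)"
    using lookup_homogenize_0[of a n] assms
    by (simp add: monomial_def prod.atLeast_Suc_atMost subset_iff[of A])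
  also have "(\<Prod>i=1..n. x i ^ lookup (homogenize (max_total A) a) i) = (\<Prod>i=1..n. x i ^ lookup a i)"
    by (rule prod.cong) (auto simp: lookup_homogenize_pos)
  finally show ?thesis using assms by (simp add: monomial_coords_def)
qed

lemma monomial_value_eq:
  assumes "finite A" "keys m \<subseteq> A"
  shows "monomial_value m v = monomial A m v"
  unfolding monomial_value_def monomial_def
  using assms by (intro prod.mono_neutral_left) (auto simp: in_keys_iff)

lemma monomial_value_coords:
  assumes "finite A" "A \<subseteq> nat_vectors n" "keys m \<subseteq> A"
  shows "monomial_value m (monomial_coords n A x) = monomial {0..n} (exponent n A m) x"
proof -
  let ?h = "homogenize (max_total A)"
  have "monomial_value m (monomial_coords n A x) = (\<Prod>a\<in>A. \<Prod>i\<in>{0..n}. x i ^ (lookup m a * lookup (?h a) i))"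
    unfolding monomial_value_eq[OF assms(1,3)] monomial_def[of A]
  proof (rule prod.cong[OF refl])
    fix a assume "a \<in> A"
    then show "monomial_coords n A x a ^ lookup m a = (\<Prod>i\<in>{0..n}. x i ^ (lookup m a * lookup (?h a) i))"
      by (simp add: monomial_coords_eq[OF assms(2)] monomial_def prod_power_distrib power_mult mult.commute[of "lookup m a"])
  qed
  also have "\<dots> = (\<Prod>i\<in>{0..n}. \<Prod>a\<in>A. x i ^ (lookup m a * lookup (?h a) i))"
    by (rule prod.swap)
  also have "\<dots> = monomial {0..n} (exponent n A m) x"
    unfolding monomial_def by (rule prod.cong) (simp_all add: lookup_exponent power_sum)
  finally show ?thesis .
qed

lemma mpoly_eval_coords:
  assumes "finite A" "A \<subseteq> nat_vectors n" "f \<in> homogeneous A t"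
  shows "mpoly_eval f (monomial_coords n A x)
    = (\<Sum>w\<in>exponent n A ` keys f. (\<Sum>m\<in>{m \<in> keys f. exponent n A m = w}. lookup f m) * monomial {0..n} w x)"
proof -
  have "mpoly_eval f (monomial_coords n A x)
      = (\<Sum>m\<in>keys f. lookup f m * monomial {0..n} (exponent n A m) x)"
    unfolding mpoly_eval_def
  proof (rule sum.cong[OF refl])
    fix m assume "m \<in> keys f"
    then have "keys m \<subseteq> A" using assms(3) by (simp add: homogeneous_def)
    then show "lookup f m * monomial_value m (monomial_coords n A x)
        = lookup f m * monomial {0..n} (exponent n A m) x"
      by (simp only: monomial_value_coords[OF assms(1,2)])
  qed
  also have "\<dots> = (\<Sum>w\<in>exponent n A ` keys f. \<Sum>m\<in>{m \<in> keys f. exponent n A m = w}.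
      lookup f m * monomial {0..n} (exponent n A m) x)"
    by (rule sum.image_gen) simp
  also have "\<dots> = (\<Sum>w\<in>exponent n A ` keys f. (\<Sum>m\<in>{m \<in> keys f. exponent n A m = w}. lookup f m) * monomial {0..n} w x)"
    by (intro sum.cong refl) (simp add: sum_distrib_right)
  finally show ?thesis .
qed

lemma mpoly_eval_scale:
  assumes "f \<in> homogeneous I t"
  shows "mpoly_eval f (\<lambda>i. c * v i) = c ^ t * mpoly_eval f v"
proof -
  have "monomial_value m (\<lambda>i. c * v i) = c ^ t * monomial_value m v" if "m \<in> keys f" for m
  proof -
    have "total m = t" using assms that by (simp add: homogeneous_def)
    then show ?thesis
      by (simp add: monomial_value_def power_mult_distrib prod.distrib total_def flip: power_sum)
  qed
  then show ?thesis
    by (simp add: mpoly_eval_def sum_distrib_left mult.left_commute)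
qed

lemma vanishes_at_proj_point:
  assumes "f \<in> homogeneous I t"
  shows "vanishes_at f (proj_point v) \<longleftrightarrow> mpoly_eval f v = 0"
proof
  assume "vanishes_at f (proj_point v)"
  moreover have "v \<in> proj_point v"
    unfolding proj_point_def by (intro CollectI exI[of _ 1]) simp
  ultimately show "mpoly_eval f v = 0" unfolding vanishes_at_def by blast
next
  assume "mpoly_eval f v = 0"
  then have "mpoly_eval f (\<lambda>i. c * v i) = 0" for c
    by (simp only: mpoly_eval_scale[OF assms] mult_zero_right)
  then show "vanishes_at f (proj_point v)"
    unfolding vanishes_at_def proj_point_def by blast
qed

lemma subset_zariski_closure: "X \<subseteq> zariski_closure I X"
  unfolding zariski_closure_def by blast

text \<open>The zero set of a form that vanishes on \<open>X\<close> is itself a closed set containing \<open>X\<close>.\<close>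

lemma vanishing_forms_zariski_closure:
  assumes "X \<subseteq> proj_space I"
  shows "vanishing_forms I (zariski_closure I X) t = vanishing_forms I X t"
proof -
  have "\<forall>P\<in>zariski_closure I X. vanishes_at f P"
    if f: "f \<in> homogeneous I t" "\<forall>P\<in>X. vanishes_at f P" for f
  proof -
    let ?Z = "{P \<in> proj_space I. \<forall>g\<in>{f}. vanishes_at g P}"
    have "zariski_closed I ?Z"
      unfolding zariski_closed_def using f(1) by (intro exI[of _ "{f}"]) auto
    moreover have "X \<subseteq> ?Z" using assms f(2) by auto
    ultimately have "zariski_closure I X \<subseteq> ?Z" unfolding zariski_closure_def by blast
    then show ?thesis by auto
  qed
  then show ?thesis
    using subset_zariski_closure[of X I] by (auto simp: vanishing_forms_def)
qed

text \<open>The pullback of a form under the parametrization is a polynomial in \<open>x\<^sub>0, \<dots>, x\<^sub>n\<close> whose coefficients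
  are the sums of the coefficients of \<open>f\<close> over the fibers of \<open>exponent n A\<close>. It vanishes on the
  torus only if all of them are zero. On the torus the coordinate of \<open>0 \<in> A\<close> is nonzero, so the
  rational map is defined there.\<close>

lemma vanishing_forms_monomial_variety:
  assumes A: "finite A" "A \<subseteq> nat_vectors n" "0 \<in> A"
  shows "vanishing_forms A (monomial_variety n A :: (nat \<Rightarrow>\<^sub>0 nat, 'k::field_char_0) point set) t
    = {f \<in> homogeneous A t. \<forall>w. (\<Sum>m\<in>{m \<in> keys f. exponent n A m = w}. lookup f m) = 0}"
proof -
  have "monomial_image n A \<subseteq> (proj_space A :: (nat \<Rightarrow>\<^sub>0 nat, 'k) point set)"
    by (auto simp: monomial_image_def proj_space_def)
  then have *: "vanishing_forms A (monomial_variety n A :: (nat \<Rightarrow>\<^sub>0 nat, 'k) point set) t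
      = vanishing_forms A (monomial_image n A) t"
    unfolding monomial_variety_def by (rule vanishing_forms_zariski_closure)
  have "(\<forall>P\<in>monomial_image n A. vanishes_at f P)
      \<longleftrightarrow> (\<forall>w. (\<Sum>m\<in>{m \<in> keys f. exponent n A m = w}. lookup f m) = 0)" (is "?L \<longleftrightarrow> ?R")
    if f: "f \<in> homogeneous A t" for f :: "(nat \<Rightarrow>\<^sub>0 nat, 'k) mpoly"
  proof
    assume ?R
    then show ?L
      by (auto simp: monomial_image_def vanishes_at_proj_point[OF f] mpoly_eval_coords[OF A(1,2) f])
  next
    assume L: ?L
    define c where "c w = (\<Sum>m\<in>{m \<in> keys f. exponent n A m = w}. lookup f m)" for w
    have c0: "c w = 0" if w: "w \<in> exponent n A ` keys f" for w
    proof (rule monomials_independent[OF _ _ _ _ w])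
      fix x :: "nat \<Rightarrow> 'k" assume x: "\<forall>i. x i \<noteq> 0"
      define y where "y i = (if i \<in> {0..n} then x i else 0)" for i
      have "y \<in> coord_vectors {0..n}"
        using x by (auto simp: coord_vectors_def y_def)
      moreover have "monomial_coords n A y \<in> coord_vectors A"
        using x A(3) by (auto simp: coord_vectors_def monomial_coords_def y_def intro!: bexI[of _ 0])
      ultimately have "vanishes_at f (proj_point (monomial_coords n A y))"
        using L by (auto simp: monomial_image_def)
      then have "(\<Sum>w\<in>exponent n A ` keys f. c w * monomial {0..n} w y) = 0"
        by (simp add: vanishes_at_proj_point[OF f] mpoly_eval_coords[OF A(1,2) f] c_def)
      moreover have "monomial {0..n} w y = monomial {0..n} w x" for w
        unfolding monomial_def by (rule prod.cong) (simp_all add: y_def)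
      ultimately show "(\<Sum>w\<in>exponent n A ` keys f. c w * monomial {0..n} w x) = 0"
        by simp
    qed (use keys_exponent in auto)
    show ?R
    proof
      fix w
      show "(\<Sum>m\<in>{m \<in> keys f. exponent n A m = w}. lookup f m) = 0"
      proof (cases "w \<in> exponent n A ` keys f")
        case True
        then show ?thesis using c0 by (simp add: c_def)
      next
        case False
        then have "{m \<in> keys f. exponent n A m = w} = {}" by blast
        then show ?thesis by (simp only: sum.empty)
      qed
    qed
  qed
  then show ?thesis unfolding * by (auto simp: vanishing_forms_def)
qed

text \<open>The degree \<open>t\<close> part of the coordinate ring has as its dimension the number of fibers of
  \<open>exponent n A\<close>, and the values of this map on exponents of total \<open>t\<close> are the \<open>t\<close>-fold sums of the
  homogenized vectors.\<close>

lemma hilbert_function_monomial_variety: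
  assumes A: "finite A" "A \<subseteq> nat_vectors n" "0 \<in> A"
  shows "hilbert_function A (monomial_variety n A :: (nat \<Rightarrow>\<^sub>0 nat, 'k::field_char_0) point set) = sumset_card A"
proof
  fix t
  define M where "M = {m. keys m \<subseteq> A \<and> total m = t}"
  have M: "finite M" unfolding M_def by (rule finite_vectors_total[OF A(1)])
  have hom: "homogeneous A t = {f :: (nat \<Rightarrow>\<^sub>0 nat, 'k) mpoly. keys f \<subseteq> M}"
    by (auto simp: homogeneous_def M_def)
  have "(\<Sum>m\<in>{m \<in> keys f. exponent n A m = w}. lookup f m) = (\<Sum>m\<in>{m \<in> M. exponent n A m = w}. lookup f m)"
    if "keys f \<subseteq> M" for f :: "(nat \<Rightarrow>\<^sub>0 nat, 'k) mpoly" and w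
    using M that by (intro sum.mono_neutral_left) (auto simp: in_keys_iff)
  then have "vanishing_forms A (monomial_variety n A :: (nat \<Rightarrow>\<^sub>0 nat, 'k) point set) t
      = {f. keys f \<subseteq> M \<and> (\<forall>w. (\<Sum>m\<in>{m \<in> M. exponent n A m = w}. lookup f m) = 0)}"
    unfolding vanishing_forms_monomial_variety[OF A] hom by auto
  then have "hilbert_function A (monomial_variety n A :: (nat \<Rightarrow>\<^sub>0 nat, 'k) point set) t
      = card M - (card M - card (exponent n A ` M))"
    by (simp add: hilbert_function_def hom dim_forms[OF M] dim_fiberwise_zero_forms[OF M])
  also have "\<dots> = card (exponent n A ` M)"
    using card_image_le[OF M, of "exponent n A"] by simp
  also have "\<dots> = sumset_card A t"
    unfolding M_def exponent_image[OF A(1,2)] by (rule sumset_card_homogenize[OF A(1,2)])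
  finally show "hilbert_function A (monomial_variety n A :: (nat \<Rightarrow>\<^sub>0 nat, 'k) point set) t = sumset_card A t" .
qed


section \<open>Bounds on the phase transition\<close>

lemma phase_transition_le:
  fixes p :: "rat poly"
  assumes "\<And>t. t \<ge> N \<Longrightarrow> of_nat (sumset_card A t) = poly p (of_nat t)"
  shows "phase_transition A \<le> N"
proof -
  have "eventual_poly (sumset_card A) = p" using assms by (rule eventual_polyI)
  then show ?thesis
    unfolding phase_transition_def using assms by (intro Least_le) simp
qed

theorem theorem4p6:
  fixes n :: nat and A :: "(nat \<Rightarrow>\<^sub>0 nat) set"
    and Y :: "(nat \<Rightarrow>\<^sub>0 nat, 'k::{alg_closed_field, field_char_0}) point set"
  assumes "n \<ge> 1"
    and "finite A"
    and "A \<subseteq> nat_vectors n"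
    and "0 \<in> A"
    and "\<forall>i\<in>{1..n}. Poly_Mapping.single i (max_total A) \<in> A"
    and "max_total A \<ge> 1"
    and "Y = monomial_variety n A"
  shows "int (phase_transition A) \<le> (int (max_total A) - 1) * (int (card A) - int n - 1) + 1
    \<and> (variety_degree A Y \<ge> of_nat (card A) - of_nat n + 1 \<longrightarrow>
        of_nat (phase_transition A) \<le>
          min ((of_nat n + 1) * (variety_degree A Y - of_nat (card A) + of_nat n - 1) + 3)
              ((of_nat (max_total A) - 1) * (of_nat (card A) - of_nat n - 1) + 1))"
proof -
  define d where "d = max_total A"
  define H where "H = homogenize d ` A"
  have vertex: "Poly_Mapping.single i d \<in> H" if "i \<in> {0..n}" for i
  proof (cases "i = 0")
    case True
    then show ?thesis
      using assms(4) by (auto simp: H_def homogenize_def intro!: image_eqI[of _ _ 0])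
  next
    case False
    then show ?thesis
      using assms(5) that
      by (auto simp: H_def homogenize_def d_def intro!: image_eqI[of _ _ "Poly_Mapping.single i (max_total A)"])
  qed
  interpret simplicial_set "{0..n}" n d H
  proof
    show "keys a \<subseteq> {0..n}" "total a = d" if "a \<in> H" for a
      using that keys_homogenize assms(3) total_le_max_total[OF assms(2)]
      by (auto simp: H_def d_def total_homogenize)
  qed (use assms(2,6) vertex in \<open>auto simp: H_def d_def\<close>)
  have card_H: "card H = card A"
    unfolding H_def using inj_on_homogenize assms(3) by (intro card_image) (rule inj_on_subset)
  have inj: "inj_on (\<lambda>i. Poly_Mapping.single i d) {0..n}"
    using d_pos by (intro inj_onI) (metis lookup_single_eq lookup_single_not_eq less_irrefl)
  have sub: "(\<lambda>i. Poly_Mapping.single i d) ` {0..n} \<subseteq> H" using vertex by blast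
  define c where "c = card nonvertices"
  have card_A: "card A = c + n + 1"
  proof -
    have "c = card H - (n + 1)"
      unfolding c_def nonvertices_def using sub by (simp add: card_Diff_subset card_image[OF inj])
    moreover have "n + 1 \<le> card H"
      using card_mono[OF finite_H sub] by (simp add: card_image[OF inj])
    ultimately show ?thesis using card_H by simp
  qed
  have card_sumset: "card (sumset t H) = sumset_card A t" for t
    unfolding H_def d_def by (rule sumset_card_homogenize[OF assms(2,3)])
  obtain p :: "rat poly" where p: "degree p = n" "lead_coeff p = of_nat (card residues) / fact n"
    and p_eq: "\<And>t. t \<ge> (d - 1) * c \<Longrightarrow> of_nat (sumset_card A t) = poly p (of_nat t)"
    using card_sumset_poly_multiplicity_bound unfolding card_sumset c_def by blast
  have "phase_transition A \<le> (d - 1) * c" using p_eq by (rule phase_transition_le)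
  moreover have d1: "int (d - 1) = int d - 1" using d_pos by simp
  moreover have c1: "int c = int (card A) - int n - 1" by (simp add: card_A)
  ultimately have bound1: "int (phase_transition A) \<le> (int d - 1) * (int (card A) - int n - 1) + 1"
    by (metis add_increasing2 of_nat_mono of_nat_mult zero_le_one)
  have "hilbert_poly A Y = p"
    unfolding hilbert_poly_def assms(7) hilbert_function_monomial_variety[OF assms(2,3,4)]
    using p_eq by (rule eventual_polyI)
  then have deg: "variety_degree A Y = of_nat (card residues)"
    using p by (simp add: variety_degree_def)
  have "of_nat (phase_transition A) \<le>
          min ((of_nat n + 1) * (variety_degree A Y - of_nat (card A) + of_nat n - 1) + 3)
              ((of_nat d - 1) * (of_nat (card A) - of_nat n - 1) + 1)"
    if "variety_degree A Y \<ge> of_nat (card A) - of_nat n + 1"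
  proof -
    have "rat_of_nat (c + 2) \<le> of_nat (card residues)" using that deg by (simp add: card_A)
    then obtain k where k: "card residues = c + 2 + k"
      using le_Suc_ex of_nat_le_iff by blast
    (* k + 2 bounds the degrees of minimal elements, and (n + 1) * (k + 2) - 2 * n <= N *)
    define N where "N = Suc n * k + 3"
    have "Suc n * (card residues - card nonvertices) \<le> N + 2 * n"
      by (simp add: k N_def c_def[symmetric])
    then obtain q :: "rat poly" where q: "\<And>t. t \<ge> N \<Longrightarrow> of_nat (sumset_card A t) = poly q (of_nat t)"
      using card_sumset_poly_length_bound unfolding card_sumset by blast
    have "phase_transition A \<le> N" using q by (rule phase_transition_le)
    then have "rat_of_nat (phase_transition A) \<le> of_nat N" by (rule of_nat_mono)
    also have "\<dots> = (of_nat n + 1) * (variety_degree A Y - of_nat (card A) + of_nat n - 1) + 3"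
      by (simp add: N_def deg k card_A algebra_simps)
    finally have "rat_of_nat (phase_transition A)
      \<le> (of_nat n + 1) * (variety_degree A Y - of_nat (card A) + of_nat n - 1) + 3" .
    moreover have "rat_of_int (int (phase_transition A)) \<le> of_int ((int d - 1) * (int (card A) - int n - 1) + 1)"
      using bound1 by (rule of_int_le_iff[THEN iffD2])
    ultimately show ?thesis by simp
  qed
  then show ?thesis using bound1 by (simp add: d_def)
qed

end
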